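(* Let $p$ be a prime and let $G$ be $\mathrm{SL}(2,q)$ or $\mathrm{PSL}(2,q)$ with $q$ a prime power. Then $G$ has a redundant Sylow $p$-subgroup if and only if $p=2$ and $q$ is not of any of the forms $2^k-1$, $2^k$, $2^k+1$ for an integer $k$.
   Context: For a finite group $G$ and a prime $p$, $G_p$ denotes the set of $p$-elements of $G$ and $\mathrm{Syl}_p(G)$ the set of Sylow $p$-subgroups of $G$. $G$ is said to have a redundant Sylow $p$-subgroup if $G_p$ is contained in the union of the members of some proper subset of $\mathrm{Syl}_p(G)$. *)

theory Defs
  imports "HOL-Computational_Algebra.Primes" "HOL-Algebra.Multiplicative_Group" "HOL-Algebra.Coset"
begin

definition p_elements :: "('g, 'b) monoid_scheme \<Rightarrow> nat \<Rightarrow> 'g set" where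
  "p_elements G p = {x \<in> carrier G. \<exists>n::nat. group.ord G x = p ^ n}"

definition Sylow_subgroups :: "('g, 'b) monoid_scheme \<Rightarrow> nat \<Rightarrow> 'g set set" where
  "Sylow_subgroups G p =
     {P. subgroup P G \<and> card P = p ^ multiplicity p (order G)}"

definition has_redundant_Sylow :: "('g, 'b) monoid_scheme \<Rightarrow> nat \<Rightarrow> bool" where
  "has_redundant_Sylow G p \<longleftrightarrow>
     (\<exists>S. S \<subset> Sylow_subgroups G p \<and> p_elements G p \<subseteq> \<Union>S)"

text \<open>SL(2,F) for a field F (type 'a): 2x2 matrices (a,b,c,d) = [[a,b],[c,d]]
  of determinant 1, under matrix multiplication.\<close>
definition mat2_mult :: "'a::field * 'a * 'a * 'a \<Rightarrow> 'a * 'a * 'a * 'a \<Rightarrow> 'a * 'a * 'a * 'a" where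
  "mat2_mult M N = (case M of (a, b, c, d) \<Rightarrow> case N of (a2, b2, c2, d2) \<Rightarrow>
     (a * a2 + b * c2, a * b2 + b * d2, c * a2 + d * c2, c * b2 + d * d2))"

definition SL2 :: "('a::field * 'a * 'a * 'a) monoid" where
  "SL2 = \<lparr> carrier = {M. case M of (a, b, c, d) \<Rightarrow> a * d - b * c = 1},
           mult = mat2_mult,
           one = (1, 0, 0, 1) \<rparr>"

definition SL2_centre :: "('a::field * 'a * 'a * 'a) set" where
  "SL2_centre = {(1, 0, 0, 1), (-1, 0, 0, -1)}"

definition PSL2 :: "('a::field * 'a * 'a * 'a) set monoid" where
  "PSL2 = SL2 Mod SL2_centre"

end

theory Submission
  imports Defs "HOL-Algebra.Sylow" "HOL-Algebra.Group_Action" "HOL-Library.Cardinality"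
begin

text \<open>
  By Sylow's conjugacy theorem, a group has a redundant Sylow \<open>p\<close>-subgroup iff no \<open>p\<close>-element lies
  in a unique Sylow \<open>p\<close>-subgroup. This property passes to and from central quotients because central
  \<open>p\<close>-elements lie in every Sylow \<open>p\<close>-subgroup. Write \<open>q = |F|\<close>. If \<open>p\<close> divides \<open>q\<close>, a transvection
  fixes a single line and so lies in a single Sylow subgroup. If \<open>p\<close> is odd and does not divide \<open>q\<close>,
  the Sylow \<open>p\<close>-subgroups are cyclic, because \<open>p\<close> divides at most one of \<open>q - 1\<close>, \<open>q + 1\<close> and both
  numbers are orders of cyclic tori of \<open>SL(2,q)\<close>; a generator of a cyclic Sylow subgroup lies in no
  other one.

  Let \<open>p = 2\<close> and \<open>q\<close> odd, let \<open>T\<close> be the cyclic torus whose order \<open>N\<close>, one of \<open>q - 1\<close> and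
  \<open>q + 1\<close>, is divisible by 4, and let \<open>x\<close> generate the Sylow 2-subgroup \<open>S\<close> of \<open>T\<close>, which has
  index 2 in the Sylow 2-subgroups of \<open>SL(2,q)\<close> above it. Elements of such a Sylow subgroup \<open>P\<close>
  outside \<open>S\<close> invert \<open>T\<close> and square to \<open>-1\<close>. Since all elements with square \<open>-1\<close> have trace 0 and
  are therefore conjugate, every 2-element is conjugate into \<open>S\<close>, so only \<open>x\<close> matters. If \<open>N\<close> is a
  power of 2, then \<open>P\<close> consists of the elements that centralize or invert \<open>x\<close> and is unique.
  Otherwise a nontrivial \<open>r\<close> of odd order in \<open>T\<close> centralizes \<open>x\<close> but does not normalize \<open>P\<close>: for
  \<open>w\<close> in \<open>P\<close> outside \<open>S\<close>, the commutator of \<open>r\<close> and \<open>w\<close> is \<open>r\<^sup>2\<close>, of odd order.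
\<close>

section \<open>Sylow subgroups and epimorphisms\<close>

lemma (in group) card_subgroup_dvd_card_subgroup:
  assumes "subgroup A G" "subgroup B G" "A \<subseteq> B"
  shows "card A dvd card B"
proof -
  interpret B: group "G\<lparr>carrier := B\<rparr>" using assms(2) by (rule subgroup_imp_group)
  have "subgroup A (G\<lparr>carrier := B\<rparr>)" using assms by (simp add: subgroup_incl)
  then have "card (rcosets\<^bsub>G\<lparr>carrier := B\<rparr>\<^esub> A) * card A = card B"
    using B.lagrange by (simp add: order_def)
  then show ?thesis by (metis dvd_triv_right)
qed

lemma (in group) ord_dvd_card_subgroup:
  assumes "subgroup P G" "x \<in> P"
  shows "ord x dvd card P"
proof -
  have x: "x \<in> carrier G" by (rule subgroup.mem_carrier[OF assms])
  then have "subgroup (generate G {x}) G" by (simp add: generate_is_subgroup)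
  moreover have "generate G {x} \<subseteq> P" using assms by (simp add: generate_subgroup_incl)
  ultimately show ?thesis
    using card_subgroup_dvd_card_subgroup assms(1) generate_pow_card[OF x] by metis
qed

lemma (in group) mem_p_elements_iff:
  assumes "prime p"
  shows "x \<in> p_elements G p \<longleftrightarrow> x \<in> carrier G \<and> (\<exists>n. x [^] (p ^ n) = \<one>)"
proof -
  have "(\<exists>n. ord x = p ^ n) \<longleftrightarrow> (\<exists>n. ord x dvd p ^ n)"
    using divides_primepow_nat[OF assms] dvd_refl by metis
  then show ?thesis by (auto simp: p_elements_def pow_eq_id)
qed

lemma (in group) p_elements_mult_closed:
  assumes p: "prime p" and x: "x \<in> p_elements G p" and y: "y \<in> p_elements G p"
    and comm: "x \<otimes> y = y \<otimes> x"
  shows "x \<otimes> y \<in> p_elements G p"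
proof -
  obtain m n where pow: "x [^] (p ^ m) = \<one>" "y [^] (p ^ n) = \<one>"
    and carr: "x \<in> carrier G" "y \<in> carrier G"
    using x y by (auto simp: mem_p_elements_iff[OF p])
  have "x [^] (p ^ (m + n)) = \<one>"
    using pow(1) carr by (simp add: power_add flip: nat_pow_pow)
  moreover have "y [^] (p ^ (m + n)) = \<one>"
    using pow(2) carr by (simp add: add.commute[of m] power_add flip: nat_pow_pow)
  ultimately have "(x \<otimes> y) [^] (p ^ (m + n)) = \<one>"
    using carr comm by (simp add: pow_mult_distrib)
  then show ?thesis using carr by (auto simp: mem_p_elements_iff[OF p])
qed

lemma (in group_hom) hom_p_elements:
  assumes p: "prime p" and x: "x \<in> p_elements G p"
  shows "h x \<in> p_elements H p"
proof -
  obtain n where "x \<in> carrier G" "x [^] (p ^ n) = \<one>"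
    using x by (auto simp: G.mem_p_elements_iff[OF p])
  then have "h x [^]\<^bsub>H\<^esub> (p ^ n) = \<one>\<^bsub>H\<^esub>" by (simp flip: hom_nat_pow)
  then show ?thesis using \<open>x \<in> carrier G\<close> by (auto simp: H.mem_p_elements_iff[OF p])
qed

lemma (in group_hom) order_eq_order_times_card_kernel:
  assumes surj: "h ` carrier G = carrier H"
  shows "order G = order H * card (kernel G H h)"
proof -
  have "card (carrier (G Mod kernel G H h)) = card (carrier H)"
    using FactGroup_iso_set[OF surj] by (auto simp: iso_def dest: bij_betw_same_card)
  then show ?thesis
    using G.lagrange[OF subgroup_kernel] by (simp add: FactGroup_def order_def)
qed

lemma (in group_hom) kernel_eq_generate:
  assumes surj: "h ` carrier G = carrier H" and fin: "finite (carrier G)"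
    and g: "g \<in> carrier G" "generate G {g} = carrier G"
  shows "kernel G H h = generate G {g [^] order H}"
proof -
  let ?u = "g [^] order H"
  have "h ?u = \<one>\<^bsub>H\<^esub>" using g(1) by (simp add: hom_nat_pow H.pow_order_eq_1)
  then have "generate G {?u} \<subseteq> kernel G H h"
    using g(1) by (intro G.generate_subgroup_incl subgroup_kernel) (simp add: kernel_def)
  moreover have "card (generate G {?u}) = card (kernel G H h)"
  proof -
    have "G.ord g = order H * card (kernel G H h)"
      using order_eq_order_times_card_kernel[OF surj] G.generate_pow_card[OF g(1)] g(2)
      by (simp add: order_def)
    moreover have "order H \<noteq> 0"
      using fin surj H.order_gt_0_iff_finite by (metis finite_imageI less_not_refl)
    ultimately show ?thesis
      using G.ord_pow[OF g(1), of "order H"] g(1) by (simp flip: G.generate_pow_card)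
  qed
  moreover have "finite (kernel G H h)" using fin by (simp add: kernel_def)
  ultimately show ?thesis by (metis card_subset_eq)
qed

lemma (in group_hom) card_eq_card_image_times_card_kernel:
  assumes P: "subgroup P G"
  shows "card P = card (h ` P) * card (kernel G H h \<inter> P)"
proof -
  let ?G = "G\<lparr>carrier := P\<rparr>" and ?H = "H\<lparr>carrier := h ` P\<rparr>"
  have "h \<in> hom ?G ?H"
    using subgroup.mem_carrier[OF P] by (auto simp: hom_def)
  then interpret P: group_hom ?G ?H h
    using G.subgroup_imp_group[OF P] H.subgroup_imp_group[OF subgroup_img_is_subgroup[OF P]]
    by (intro group_hom.intro group_hom_axioms.intro)
  have "kernel ?G ?H h = kernel G H h \<inter> P"
    using subgroup.subset[OF P] by (auto simp: kernel_def)
  then show ?thesis using P.order_eq_order_times_card_kernel by (simp add: order_def)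
qed

lemma (in group_hom) image_Sylow:
  assumes surj: "h ` carrier G = carrier H" and fin: "finite (carrier G)" and p: "prime p"
    and P: "P \<in> Sylow_subgroups G p"
  shows "h ` P \<in> Sylow_subgroups H p"
proof -
  let ?K = "kernel G H h"
  have sub: "subgroup P G" and card_P: "card P = p ^ multiplicity p (order G)"
    using P by (auto simp: Sylow_subgroups_def)
  have sub_image: "subgroup (h ` P) H" by (rule subgroup_img_is_subgroup[OF sub])
  note order_G = order_eq_order_times_card_kernel[OF surj]
    and card_P_eq = card_eq_card_image_times_card_kernel[OF sub]
  have "order G \<noteq> 0" using fin G.order_gt_0_iff_finite by simp
  then have order_nz: "order H \<noteq> 0" "card ?K \<noteq> 0" using order_G by auto
  have "card P \<noteq> 0" using card_P p by simp
  then have card_nz: "card (h ` P) \<noteq> 0" "card (?K \<inter> P) \<noteq> 0" using card_P_eq by auto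
  have "multiplicity p (order H) + multiplicity p (card ?K) = multiplicity p (card P)"
    using order_nz p by (simp add: card_P order_G prime_elem_multiplicity_mult_distrib)
  also have "\<dots> = multiplicity p (card (h ` P)) + multiplicity p (card (?K \<inter> P))"
    using card_nz p by (simp add: card_P_eq prime_elem_multiplicity_mult_distrib)
  also have "multiplicity p (card (?K \<inter> P)) \<le> multiplicity p (card ?K)"
    using G.card_subgroup_dvd_card_subgroup[of "?K \<inter> P" ?K] subgroup_kernel sub order_nz
    by (simp add: G.subgroups_Inter_pair dvd_imp_multiplicity_le)
  finally have "multiplicity p (order H) \<le> multiplicity p (card (h ` P))" by simp
  moreover have "card (h ` P) dvd order H"
    using H.lagrange[OF sub_image] by (metis dvd_triv_right)
  then have "multiplicity p (card (h ` P)) \<le> multiplicity p (order H)"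
    using order_nz(1) by (rule dvd_imp_multiplicity_le)
  moreover obtain a where "card (h ` P) = p ^ a"
    using card_P card_P_eq p divides_primepow_nat by (metis dvd_triv_left)
  ultimately show ?thesis using sub_image p by (simp add: Sylow_subgroups_def)
qed

section \<open>Conjugacy of Sylow subgroups\<close>

lemma (in group_action) p_group_fixed_point:
  assumes p: "prime p" and order_G: "order G = p ^ k"
    and fin: "finite E" and card_E: "\<not> p dvd card E"
  shows "\<exists>x\<in>E. \<forall>g\<in>carrier G. \<phi> g x = x"
proof -
  have "card E = (\<Sum>A\<in>orbits G E \<phi>. card A)"
    using disjoint_sum[OF fin, of "\<lambda>_. 1::nat"] by simp
  then obtain A where A: "A \<in> orbits G E \<phi>" "\<not> p dvd card A"
    using card_E by (metis dvd_sum)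
  then obtain x where x: "x \<in> E" and A_eq: "A = orbit G \<phi> x" by (auto simp: orbits_def)
  have "card A dvd p ^ k"
    using orbit_stabilizer_theorem[OF x] order_G A_eq by (metis dvd_triv_left)
  then obtain j where "card A = p ^ j" using p divides_primepow_nat by blast
  then have "card A = 1" using A(2) by (cases j) auto
  then obtain y where y: "A = {y}" by (meson card_1_singletonE)
  have "\<phi> g x \<in> A" if "g \<in> carrier G" for g using that A_eq by (auto simp: orbit_def)
  moreover have "x \<in> A" unfolding A_eq by (rule orbit_refl[OF x])
  ultimately show ?thesis using x y by auto
qed

context group
begin

lemma action_on_rcosets:
  assumes P: "subgroup P G"
  shows "group_action G (rcosets P) (\<lambda>g. \<lambda>C\<in>rcosets P. C #> inv g)"
proof -
  have subset: "C \<subseteq> carrier G" if "C \<in> rcosets P" for C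
    by (rule subgroup.rcosets_carrier[OF P is_group that])
  have closed: "C #> g \<in> rcosets P" if "C \<in> rcosets P" "g \<in> carrier G" for C g
  proof -
    obtain a where a: "a \<in> carrier G" "C = P #> a"
      using \<open>C \<in> rcosets P\<close> by (auto simp: RCOSETS_def)
    then have "C #> g = P #> (a \<otimes> g)"
      using that(2) P by (simp add: coset_mult_assoc subgroup.subset)
    then show ?thesis using a that(2) by (auto simp: RCOSETS_def)
  qed
  have assoc: "C #> g #> h = C #> (g \<otimes> h)"
    if "C \<in> rcosets P" "g \<in> carrier G" "h \<in> carrier G" for C g h
    using that subset coset_mult_assoc by simp
  have bij: "(\<lambda>C\<in>rcosets P. C #> inv g) \<in> Bij (rcosets P)" if g: "g \<in> carrier G" for g
  proof -
    have "bij_betw (\<lambda>C. C #> inv g) (rcosets P) (rcosets P)"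
      by (rule bij_betw_byWitness[where f' = "\<lambda>C. C #> g"])
        (use g in \<open>auto simp: assoc closed subset\<close>)
    then show ?thesis by (simp add: Bij_def cong: bij_betw_cong)
  qed
  have mult: "(\<lambda>C\<in>rcosets P. C #> inv (g \<otimes> h)) =
      (\<lambda>C\<in>rcosets P. C #> inv g) \<otimes>\<^bsub>BijGroup (rcosets P)\<^esub> (\<lambda>C\<in>rcosets P. C #> inv h)"
    if "g \<in> carrier G" "h \<in> carrier G" for g h
    using that
    by (auto simp: BijGroup_def compose_def bij inv_mult_group closed assoc intro!: restrict_ext)
  have "(\<lambda>g. \<lambda>C\<in>rcosets P. C #> inv g) \<in> hom G (BijGroup (rcosets P))"
    by (rule homI) (auto simp: mult bij BijGroup_def)
  then show ?thesis
    by (intro group_action.intro group_hom.intro group_hom_axioms.intro group_BijGroup is_group)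
qed

abbreviation conj_by :: "'a \<Rightarrow> 'a \<Rightarrow> 'a" where
  "conj_by g x \<equiv> g \<otimes> x \<otimes> inv g"

lemma conj_by_group_hom:
  assumes "g \<in> carrier G"
  shows "group_hom G G (conj_by g)"
proof -
  have "conj_by g (x \<otimes> y) = conj_by g x \<otimes> conj_by g y" if "x \<in> carrier G" "y \<in> carrier G" for x y
    using assms that by (simp add: m_assoc inv_solve_left)
  then have "conj_by g \<in> hom G G" using assms by (auto intro: homI)
  then show ?thesis by (intro group_hom.intro group_hom_axioms.intro is_group)
qed

lemma conj_by_inv_cancel:
  assumes "g \<in> carrier G" "x \<in> carrier G"
  shows "conj_by (inv g) (conj_by g x) = x" "conj_by g (conj_by (inv g) x) = x"
  using assms by (metis inv_closed inv_inv conjugation_is_surj)+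

lemma conj_by_image_cancel:
  assumes "g \<in> carrier G" "A \<subseteq> carrier G"
  shows "conj_by g ` conj_by (inv g) ` A = A"
proof -
  have "conj_by g ` conj_by (inv g) ` A = (\<lambda>x. x) ` A"
    unfolding image_image using assms conj_by_inv_cancel(2) by (intro image_cong) auto
  then show ?thesis by simp
qed

lemma conj_by_mult:
  assumes "g \<in> carrier G" "h \<in> carrier G" "x \<in> carrier G"
  shows "conj_by (g \<otimes> h) x = conj_by g (conj_by h x)"
  using assms by (simp add: m_assoc inv_mult_group)

lemma conj_by_eq_iff_commute:
  assumes "g \<in> carrier G" "x \<in> carrier G"
  shows "conj_by g x = x \<longleftrightarrow> g \<otimes> x = x \<otimes> g"
  using assms by (metis inv_solve_right m_closed)

lemma conj_by_image_carrier:
  assumes "g \<in> carrier G"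
  shows "conj_by g ` carrier G = carrier G"
  using conjugation_is_bij[OF assms] by (simp add: bij_betw_def)

end

locale finite_group_prime = group G for G (structure) +
  fixes p :: nat
  assumes finite_carrier: "finite (carrier G)" and prime_p: "prime p"
begin

lemma Sylow_exists: "\<exists>P. P \<in> Sylow_subgroups G p"
proof -
  obtain m where "order G = p ^ multiplicity p (order G) * m" using multiplicity_dvd by blast
  from sylow_thm[OF prime_p is_group this finite_carrier] show ?thesis
    by (auto simp: Sylow_subgroups_def)
qed

lemma Sylow_subgroup: "P \<in> Sylow_subgroups G p \<Longrightarrow> subgroup P G"
  by (simp add: Sylow_subgroups_def)

lemma Sylow_card: "P \<in> Sylow_subgroups G p \<Longrightarrow> card P = p ^ multiplicity p (order G)"
  by (simp add: Sylow_subgroups_def)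

lemma Sylow_subset_carrier: "P \<in> Sylow_subgroups G p \<Longrightarrow> P \<subseteq> carrier G"
  by (intro subgroup.subset Sylow_subgroup)

lemma Sylow_finite: "P \<in> Sylow_subgroups G p \<Longrightarrow> finite P"
  using Sylow_subset_carrier finite_carrier finite_subset by blast

lemma Sylow_eqI:
  assumes "P \<in> Sylow_subgroups G p" "Q \<in> Sylow_subgroups G p" "P \<subseteq> Q"
  shows "P = Q"
  using assms by (simp add: card_subset_eq Sylow_card Sylow_finite)

lemma Sylow_subset_p_elements:
  assumes P: "P \<in> Sylow_subgroups G p"
  shows "P \<subseteq> p_elements G p"
proof
  fix x assume "x \<in> P"
  moreover from this have "ord x dvd p ^ multiplicity p (order G)"
    using ord_dvd_card_subgroup Sylow_subgroup[OF P] Sylow_card[OF P] by metis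
  ultimately show "x \<in> p_elements G p"
    using P Sylow_subset_carrier prime_p divides_primepow_nat by (auto simp: p_elements_def)
qed

lemma conj_by_Sylow:
  assumes P: "P \<in> Sylow_subgroups G p" and g: "g \<in> carrier G"
  shows "conj_by g ` P \<in> Sylow_subgroups G p"
  by (rule group_hom.image_Sylow[OF conj_by_group_hom[OF g] conj_by_image_carrier[OF g]
      finite_carrier prime_p P])

lemma not_dvd_card_rcosets_Sylow:
  assumes P: "P \<in> Sylow_subgroups G p"
  shows "\<not> p dvd card (rcosets P)"
proof
  assume "p dvd card (rcosets P)"
  then have "p ^ Suc (multiplicity p (order G)) dvd card (rcosets P) * card P"
    by (simp add: Sylow_card[OF P] mult_dvd_mono)
  then have "p ^ Suc (multiplicity p (order G)) dvd order G"
    using lagrange[OF Sylow_subgroup[OF P]] by simp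
  moreover have "order G \<noteq> 0" using finite_carrier order_gt_0_iff_finite by simp
  ultimately show False
    using prime_p not_prime_unit power_dvd_iff_le_multiplicity by (metis Suc_n_not_le_n)
qed

lemma p_subgroup_le_conj_Sylow:
  assumes P: "P \<in> Sylow_subgroups G p" and Q: "subgroup Q G" "card Q = p ^ k"
  shows "\<exists>g\<in>carrier G. Q \<subseteq> conj_by g ` P"
proof -
  note sub = Sylow_subgroup[OF P] and subset = Sylow_subset_carrier[OF P]
  interpret Q: group_action "G\<lparr>carrier := Q\<rparr>" "rcosets P" "\<lambda>g. \<lambda>C\<in>rcosets P. C #> inv g"
    by (rule group_action.induced_action[OF action_on_rcosets[OF sub] Q(1)])
  have "finite (rcosets P)"
    using finite_carrier rcosets_subset_PowG[OF sub] by (meson finite_Pow_iff finite_subset)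
  moreover have "order (G\<lparr>carrier := Q\<rparr>) = p ^ k" using Q by (simp add: order_def)
  ultimately obtain C where "C \<in> rcosets P" and fixed: "\<And>g. g \<in> Q \<Longrightarrow> C #> inv g = C"
    using Q.p_group_fixed_point[OF prime_p _ _ not_dvd_card_rcosets_Sylow[OF P], of k] by auto
  then obtain a where a: "a \<in> carrier G" "C = P #> a" by (auto simp: RCOSETS_def)
  have "q \<in> conj_by (inv a) ` P" if q: "q \<in> Q" for q
  proof
    have q_carrier: "q \<in> carrier G" by (rule subgroup.mem_carrier[OF Q(1) q])
    have "P #> (a \<otimes> q) = P #> a"
      using fixed[OF subgroup.m_inv_closed[OF Q(1) q]] a q_carrier subset
      by (simp add: coset_mult_assoc)
    then have "a \<otimes> q \<in> P #> a" using rcos_self[OF _ sub, of "a \<otimes> q"] a q_carrier by simp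
    then show "conj_by a q \<in> P"
      using a q_carrier subgroup.rcos_module_imp[OF sub is_group] by simp
    show "q = conj_by (inv a) (conj_by a q)"
      using conj_by_inv_cancel(1)[OF a(1) q_carrier] by (rule sym)
  qed
  then show ?thesis using a by (meson inv_closed subsetI)
qed

lemma Sylow_conj:
  assumes P: "P \<in> Sylow_subgroups G p" and Q: "Q \<in> Sylow_subgroups G p"
  shows "\<exists>g\<in>carrier G. Q = conj_by g ` P"
  using p_subgroup_le_conj_Sylow[OF P Sylow_subgroup[OF Q] Sylow_card[OF Q]]
    Sylow_eqI[OF Q conj_by_Sylow[OF P]] by blast

lemma p_element_in_Sylow:
  assumes "x \<in> p_elements G p"
  shows "\<exists>P\<in>Sylow_subgroups G p. x \<in> P"
proof -
  obtain n where x: "x \<in> carrier G" "ord x = p ^ n" using assms by (auto simp: p_elements_def)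
  obtain P where P: "P \<in> Sylow_subgroups G p" using Sylow_exists by blast
  have "subgroup (generate G {x}) G" using x by (simp add: generate_is_subgroup)
  moreover have "card (generate G {x}) = p ^ n" using x by (simp flip: generate_pow_card)
  ultimately obtain g where "g \<in> carrier G" "generate G {x} \<subseteq> conj_by g ` P"
    using p_subgroup_le_conj_Sylow[OF P] by blast
  moreover have "x \<in> generate G {x}" by (simp add: generate.incl)
  ultimately show ?thesis using conj_by_Sylow[OF P] by blast
qed

lemma central_p_element_in_Sylow:
  assumes z: "z \<in> p_elements G p" and central: "\<And>g. g \<in> carrier G \<Longrightarrow> z \<otimes> g = g \<otimes> z"
    and Q: "Q \<in> Sylow_subgroups G p"
  shows "z \<in> Q"
proof -
  obtain P where P: "P \<in> Sylow_subgroups G p" "z \<in> P" using p_element_in_Sylow[OF z] by blast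
  obtain g where g: "g \<in> carrier G" "Q = conj_by g ` P" using Sylow_conj[OF P(1) Q] by blast
  have "conj_by g z = z"
    using z g central by (simp add: conj_by_eq_iff_commute p_elements_def)
  then show ?thesis using P g by (metis imageI)
qed

end

section \<open>Elements lying in a unique Sylow subgroup\<close>

definition in_unique_Sylow :: "('g, 'b) monoid_scheme \<Rightarrow> nat \<Rightarrow> 'g \<Rightarrow> bool" where
  "in_unique_Sylow G p x \<longleftrightarrow> (\<exists>!P. P \<in> Sylow_subgroups G p \<and> x \<in> P)"

context finite_group_prime
begin

lemma in_unique_Sylow_conj_by:
  assumes g: "g \<in> carrier G" and x: "x \<in> carrier G" and unique: "in_unique_Sylow G p x"
  shows "in_unique_Sylow G p (conj_by g x)"
proof -
  obtain P where P: "P \<in> Sylow_subgroups G p" "x \<in> P"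
    and P_unique: "\<And>Q. Q \<in> Sylow_subgroups G p \<Longrightarrow> x \<in> Q \<Longrightarrow> Q = P"
    using unique by (auto simp: in_unique_Sylow_def)
  show ?thesis unfolding in_unique_Sylow_def
  proof (rule ex1I)
    show "conj_by g ` P \<in> Sylow_subgroups G p \<and> conj_by g x \<in> conj_by g ` P"
      using conj_by_Sylow P g by blast
    fix Q assume Q: "Q \<in> Sylow_subgroups G p \<and> conj_by g x \<in> Q"
    then have "conj_by (inv g) (conj_by g x) \<in> conj_by (inv g) ` Q" by blast
    then have "x \<in> conj_by (inv g) ` Q" by (simp only: conj_by_inv_cancel(1)[OF g x])
    then have "conj_by (inv g) ` Q = P"
      using P_unique conj_by_Sylow[of Q "inv g"] Q g by blast
    then show "Q = conj_by g ` P"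
      using conj_by_image_cancel[OF g, of Q] Q Sylow_subset_carrier by metis
  qed
qed

theorem has_redundant_Sylow_iff:
  "has_redundant_Sylow G p \<longleftrightarrow> (\<forall>x\<in>p_elements G p. \<not> in_unique_Sylow G p x)"
proof
  assume "has_redundant_Sylow G p"
  then obtain S Q where S: "S \<subset> Sylow_subgroups G p" "p_elements G p \<subseteq> \<Union>S"
    and Q: "Q \<in> Sylow_subgroups G p" "Q \<notin> S"
    by (auto simp: has_redundant_Sylow_def)
  show "\<forall>x\<in>p_elements G p. \<not> in_unique_Sylow G p x"
  proof (intro ballI notI)
    fix x assume x: "x \<in> p_elements G p" and unique: "in_unique_Sylow G p x"
    obtain P where P: "P \<in> Sylow_subgroups G p" "x \<in> P" using p_element_in_Sylow[OF x] by blast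
    obtain g where g: "g \<in> carrier G" "Q = conj_by g ` P" using Sylow_conj[OF P(1) Q(1)] by blast
    have "conj_by g x \<in> p_elements G p"
      using group_hom.hom_p_elements[OF conj_by_group_hom[OF g(1)] prime_p x] .
    then obtain R where "R \<in> S" "conj_by g x \<in> R" using S(2) by blast
    moreover have "conj_by g x \<in> Q" using P(2) g(2) by blast
    moreover have "in_unique_Sylow G p (conj_by g x)"
      using x unique by (simp add: in_unique_Sylow_conj_by[OF g(1)] p_elements_def)
    ultimately show False using S(1) Q unfolding in_unique_Sylow_def by blast
  qed
next
  assume no_unique: "\<forall>x\<in>p_elements G p. \<not> in_unique_Sylow G p x"
  obtain P where P: "P \<in> Sylow_subgroups G p" using Sylow_exists by blast
  have "p_elements G p \<subseteq> \<Union>(Sylow_subgroups G p - {P})"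
  proof
    fix x assume x: "x \<in> p_elements G p"
    then obtain Q where "Q \<in> Sylow_subgroups G p" "x \<in> Q" using p_element_in_Sylow by blast
    then show "x \<in> \<Union>(Sylow_subgroups G p - {P})"
      using no_unique x unfolding in_unique_Sylow_def by blast
  qed
  then show "has_redundant_Sylow G p" using P unfolding has_redundant_Sylow_def by blast
qed

lemma not_redundant_if_multiplicity_ord_eq:
  assumes x: "x \<in> carrier G" and ord_x: "multiplicity p (ord x) = multiplicity p (order G)"
  shows "\<not> has_redundant_Sylow G p"
proof -
  let ?n = "multiplicity p (order G)"
  obtain m where m: "ord x = p ^ ?n * m" using ord_x multiplicity_dvd[of p "ord x"] by auto
  define y where "y = x [^] m"
  have y: "y \<in> carrier G" using x by (simp add: y_def)
  have "m \<noteq> 0" using m ord_ge_1[OF finite_carrier x] by auto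
  then have ord_y: "ord y = p ^ ?n" using ord_pow[OF x, of m] m by (simp add: y_def)
  have Y: "generate G {y} \<in> Sylow_subgroups G p"
    using y ord_y by (simp add: Sylow_subgroups_def generate_is_subgroup flip: generate_pow_card)
  have "in_unique_Sylow G p y" unfolding in_unique_Sylow_def
  proof (rule ex1I)
    show "generate G {y} \<in> Sylow_subgroups G p \<and> y \<in> generate G {y}"
      using Y by (simp add: generate.incl)
    fix Q assume "Q \<in> Sylow_subgroups G p \<and> y \<in> Q"
    then show "Q = generate G {y}"
      using Sylow_eqI[OF Y, of Q] generate_subgroup_incl[of "{y}" Q] Sylow_subgroup by simp
  qed
  moreover have "y \<in> p_elements G p" using y ord_y by (auto simp: p_elements_def)
  ultimately show ?thesis using has_redundant_Sylow_iff by blast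
qed

end

section \<open>Central quotients\<close>

locale central_epi = group_hom G H h + finite_group_prime G p
  for G (structure) and H (structure) and h and p +
  assumes surj: "h ` carrier G = carrier H"
    and central: "k \<in> kernel G H h \<Longrightarrow> g \<in> carrier G \<Longrightarrow> k \<otimes> g = g \<otimes> k"
begin

sublocale H: finite_group_prime H p
  by unfold_locales (simp_all add: finite_carrier prime_p flip: surj)

lemma Sylow_eq_image:
  assumes Q: "Q \<in> Sylow_subgroups H p"
  obtains P where "P \<in> Sylow_subgroups G p" "Q = h ` P"
proof -
  obtain P where P: "P \<in> Sylow_subgroups G p" using Sylow_exists by blast
  have "h ` P \<in> Sylow_subgroups H p" by (rule image_Sylow[OF surj finite_carrier prime_p P])
  then obtain y where y: "y \<in> carrier H" "Q = H.conj_by y ` h ` P"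
    using H.Sylow_conj Q by blast
  obtain g where g: "g \<in> carrier G" "y = h g" using y surj by blast
  have "Q = h ` G.conj_by g ` P"
    using y(2) g Sylow_subset_carrier[OF P] by (auto simp: image_image subset_eq intro!: image_cong)
  then show ?thesis using that conj_by_Sylow[OF P g(1)] by blast
qed

lemma image_p_elements: "h ` p_elements G p = p_elements H p"
proof
  show "h ` p_elements G p \<subseteq> p_elements H p" using hom_p_elements prime_p by blast
  show "p_elements H p \<subseteq> h ` p_elements G p"
  proof
    fix y assume "y \<in> p_elements H p"
    then obtain Q where "Q \<in> Sylow_subgroups H p" "y \<in> Q" using H.p_element_in_Sylow by blast
    then show "y \<in> h ` p_elements G p" using Sylow_eq_image Sylow_subset_p_elements by blast
  qed
qed

lemma hom_in_image_Sylow_iff: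
  assumes P: "P \<in> Sylow_subgroups G p" and x: "x \<in> p_elements G p"
  shows "h x \<in> h ` P \<longleftrightarrow> x \<in> P"
proof
  assume "h x \<in> h ` P"
  then obtain y where y: "y \<in> P" "h x = h y" by blast
  have x_carrier: "x \<in> carrier G" using x by (simp add: p_elements_def)
  have y_carrier: "y \<in> carrier G" using P y Sylow_subset_carrier by blast
  let ?k = "inv y \<otimes> x"
  have "?k \<in> kernel G H h" using x_carrier y_carrier y by (simp add: kernel_def)
  then have k_central: "?k \<otimes> g = g \<otimes> ?k" if "g \<in> carrier G" for g using central that by blast
  have x_eq: "x = y \<otimes> ?k" using x_carrier y_carrier by (simp add: G.m_assoc[symmetric])
  have "x \<otimes> inv y = ?k"
    using k_central[OF y_carrier] x_carrier y_carrier x_eq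
    by (metis G.inv_solve_right G.inv_closed G.m_closed)
  then have "inv y \<otimes> x = x \<otimes> inv y" by simp
  moreover have "inv y \<in> p_elements G p"
    using P y(1) Sylow_subset_p_elements subgroup.m_inv_closed[OF Sylow_subgroup] by blast
  ultimately have "?k \<in> p_elements G p" using G.p_elements_mult_closed[OF prime_p _ x] by blast
  then have "?k \<in> P" using central_p_element_in_Sylow[OF _ k_central P] by blast
  then show "x \<in> P" using x_eq y(1) subgroup.m_closed[OF Sylow_subgroup[OF P]] by metis
qed blast

lemma image_Sylow_eq_iff:
  assumes "P \<in> Sylow_subgroups G p" "Q \<in> Sylow_subgroups G p"
  shows "h ` P = h ` Q \<longleftrightarrow> P = Q"
proof
  assume "h ` P = h ` Q"
  then have "P \<subseteq> Q"
    using assms hom_in_image_Sylow_iff[OF assms(2)] Sylow_subset_p_elements by blast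
  then show "P = Q" using assms Sylow_eqI by blast
qed simp

lemma in_unique_Sylow_hom_iff:
  assumes x: "x \<in> p_elements G p"
  shows "in_unique_Sylow H p (h x) \<longleftrightarrow> in_unique_Sylow G p x"
proof -
  have "bij_betw (image h) (Sylow_subgroups G p) (Sylow_subgroups H p)" unfolding bij_betw_def
  proof
    show "inj_on (image h) (Sylow_subgroups G p)"
      by (rule inj_onI) (simp only: image_Sylow_eq_iff)
    show "image h ` Sylow_subgroups G p = Sylow_subgroups H p"
      using Sylow_eq_image image_Sylow[OF surj finite_carrier prime_p] by blast
  qed
  then have "bij_betw (image h) {P \<in> Sylow_subgroups G p. x \<in> P} {Q \<in> Sylow_subgroups H p. h x \<in> Q}"
    by (rule bij_betw_Collect) (rule hom_in_image_Sylow_iff[OF _ x])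
  from bij_betw_same_card[OF this]
  have "is_singleton {P \<in> Sylow_subgroups G p. x \<in> P} \<longleftrightarrow>
    is_singleton {Q \<in> Sylow_subgroups H p. h x \<in> Q}"
    by (simp add: is_singleton_altdef)
  then show ?thesis by (simp add: is_singleton_iff_ex1 in_unique_Sylow_def)
qed

theorem has_redundant_Sylow_iff_image: "has_redundant_Sylow H p \<longleftrightarrow> has_redundant_Sylow G p"
  unfolding has_redundant_Sylow_iff H.has_redundant_Sylow_iff image_p_elements[symmetric]
  by (simp add: in_unique_Sylow_hom_iff)

end

theorem (in finite_group_prime) has_redundant_Sylow_Mod_iff:
  assumes Z: "subgroup Z G" and central: "\<And>k g. k \<in> Z \<Longrightarrow> g \<in> carrier G \<Longrightarrow> k \<otimes> g = g \<otimes> k"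
  shows "has_redundant_Sylow (G Mod Z) p \<longleftrightarrow> has_redundant_Sylow G p"
proof -
  have "conj_by g k \<in> Z" if "g \<in> carrier G" "k \<in> Z" for g k
    using that central conj_by_eq_iff_commute subgroup.mem_carrier[OF Z] by metis
  then interpret Z: normal Z G using normal_invI[OF Z] by blast
  have kernel: "kernel G (G Mod Z) ((#>) Z) = Z"
  proof (intro equalityI subsetI)
    fix x assume "x \<in> kernel G (G Mod Z) ((#>) Z)"
    then show "x \<in> Z" using rcos_self[OF _ Z] by (auto simp: kernel_def)
  next
    fix x assume "x \<in> Z"
    then show "x \<in> kernel G (G Mod Z) ((#>) Z)"
      using coset_join2[OF _ Z] subgroup.mem_carrier[OF Z] by (simp add: kernel_def)
  qed
  interpret central_epi G "G Mod Z" "(#>) Z" p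
  proof (intro central_epi.intro central_epi_axioms.intro)
    show "group_hom G (G Mod Z) ((#>) Z)"
      by (intro group_hom.intro group_hom_axioms.intro is_group
          Z.factorgroup_is_group Z.r_coset_hom_Mod)
    show "finite_group_prime G p" by (rule finite_group_prime_axioms)
    show "(#>) Z ` carrier G = carrier (G Mod Z)" by (simp add: carrier_FactGroup)
  qed (use kernel central in blast)
  show ?thesis by (rule has_redundant_Sylow_iff_image)
qed

section \<open>Tori containing half of a Sylow 2-subgroup\<close>

lemma (in group) index_two_mult_closed:
  assumes A: "subgroup A G" and P: "subgroup P G" "A \<subseteq> P" "finite P" "card P = 2 * card A"
    and u: "u \<in> P" "u \<notin> A" and v: "v \<in> P" "v \<notin> A"
  shows "u \<otimes> v \<in> A"
proof -
  let ?C = "A #> inv v"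
  have carr: "u \<in> carrier G" "v \<in> carrier G" "A \<subseteq> carrier G"
    using u v A P(1) subgroup.mem_carrier subgroup.subset by metis+
  have cosets: "A \<in> rcosets A" "?C \<in> rcosets A"
    using subgroup.subgroup_in_rcosets[OF A is_group] carr by (simp_all add: rcosetsI)
  have "A \<noteq> ?C"
    using rcos_self[OF _ A, of "inv v"] carr v subgroup.m_inv_closed[OF A, of "inv v"] by auto
  then have "A \<inter> ?C = {}"
    using rcos_disjoint[OF A] cosets by (auto simp: pairwise_def disjnt_def)
  moreover have "?C \<subseteq> P"
    using P(1,2) v(1) subgroup.m_closed subgroup.m_inv_closed by (fastforce simp: r_coset_def)
  moreover have "card ?C = card A" using card_rcosets_equal[OF cosets(2)] carr by simp
  ultimately have "A \<union> ?C = P"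
    using P by (intro card_subset_eq) (auto simp: card_Un_disjoint finite_subset)
  then obtain y where "y \<in> A" "u = y \<otimes> inv v" using u by (auto simp: r_coset_def)
  then show ?thesis using carr by (simp add: m_assoc subset_eq)
qed

lemma (in finite_group_prime) in_unique_Sylow_if_in_generate:
  assumes x: "x \<in> p_elements G p" and s: "s \<in> generate G {x}" "in_unique_Sylow G p s"
  shows "in_unique_Sylow G p x"
proof -
  have "s \<in> P" if "P \<in> Sylow_subgroups G p" "x \<in> P" for P
    using s(1) generate_subgroup_incl[OF _ Sylow_subgroup] that by blast
  then show ?thesis
    using p_element_in_Sylow[OF x] s(2) unfolding in_unique_Sylow_def by blast
qed

text \<open>The model is a maximal torus of \<open>SL(2,q)\<close>: its Weyl group has order 2 and acts by inversion.\<close>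
locale rank_one_torus = group G for G (structure) and T Z +
  assumes T_subgroup: "subgroup T G"
    and centralizer_subset:
      "\<lbrakk>s \<in> T; s \<notin> Z; g \<in> carrier G; g \<otimes> s = s \<otimes> g\<rbrakk> \<Longrightarrow> g \<in> T"
    and fusion_inverts:
      "\<lbrakk>s \<in> T; s \<notin> Z; g \<in> carrier G; conj_by g s \<in> T\<rbrakk> \<Longrightarrow> conj_by g s \<in> {s, inv s}"

locale half_Sylow_torus =
  rank_one_torus G "generate G {t}" "{\<one>, z}" + finite_group_prime G 2 for G (structure) and t z +
  assumes t_carrier: "t \<in> carrier G" and z_carrier: "z \<in> carrier G"
    and ord_z: "ord z = 2"
    and square_eq_one: "\<lbrakk>y \<in> carrier G; y \<otimes> y = \<one>\<rbrakk> \<Longrightarrow> y \<in> {\<one>, z}"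
    and square_eq_z: "\<lbrakk>y \<in> carrier G; y' \<in> carrier G; y \<otimes> y = z; y' \<otimes> y' = z\<rbrakk> \<Longrightarrow>
      \<exists>g\<in>carrier G. y' = conj_by g y"
    and four_dvd_ord_t: "4 dvd ord t"
    and multiplicity_order: "multiplicity 2 (order G) = multiplicity 2 (ord t) + 1"
begin

abbreviation T :: "'a set" where "T \<equiv> generate G {t}"

definition a :: nat where "a = multiplicity 2 (ord t)"

definition m :: nat where "m = ord t div 2 ^ a"

definition x :: 'a where "x = t [^] m"

abbreviation S :: "'a set" where "S \<equiv> generate G {x}"

lemma ord_t: "ord t = 2 ^ a * m"
  by (simp add: a_def m_def multiplicity_dvd)

lemma ord_t_nonzero: "ord t \<noteq> 0"
  using ord_ge_1[OF finite_carrier t_carrier] by simp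

lemma odd_m: "odd m"
  unfolding a_def m_def using ord_t_nonzero
  by (intro multiplicity_decompose) auto

lemma a_ge_2: "2 \<le> a"
  unfolding a_def using four_dvd_ord_t ord_t_nonzero by (intro multiplicity_geI) auto

lemma ord_x: "ord x = 2 ^ a"
  using ord_pow[OF t_carrier, of m] ord_t ord_t_nonzero by (simp add: x_def)

lemma T_carrier: "s \<in> T \<Longrightarrow> s \<in> carrier G"
  by (rule subgroup.mem_carrier[OF T_subgroup])

lemma mem_T_iff: "s \<in> T \<longleftrightarrow> (\<exists>k::nat. s = t [^] k)"
  using generate_pow_on_finite_carrier[OF finite_carrier t_carrier] by blast

lemma T_commute:
  assumes "u \<in> T" "v \<in> T"
  shows "u \<otimes> v = v \<otimes> u"
  using assms t_carrier unfolding mem_T_iff by (auto simp: nat_pow_mult add.commute)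

lemma x_in_T: "x \<in> T"
  unfolding mem_T_iff x_def by blast

lemma x_carrier: "x \<in> carrier G"
  using x_in_T by (rule T_carrier)

lemma T_centralizes_x:
  assumes "s \<in> T"
  shows "conj_by s x = x"
  using conj_by_eq_iff_commute[OF T_carrier[OF assms] x_carrier] T_commute[OF assms x_in_T] by blast

lemma z_square: "z \<otimes> z = \<one>"
  using pow_ord_eq_1[OF z_carrier] z_carrier by (simp add: ord_z numeral_2_eq_2)

lemma x_in_S: "x \<in> S"
  by (simp add: generate.incl)

lemma S_subgroup: "subgroup S G"
  using x_carrier by (simp add: generate_is_subgroup)

lemma card_S: "card S = 2 ^ a"
  using ord_x x_carrier by (simp flip: generate_pow_card)

lemma x_p_element: "x \<in> p_elements G 2"
  using x_carrier ord_x by (auto simp: p_elements_def)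

lemma x_noncentral: "x \<notin> {\<one>, z}"
proof -
  have "2 ^ 2 \<le> ord x" unfolding ord_x using a_ge_2 by (rule power_increasing) simp
  then show ?thesis using ord_z by auto
qed

lemma S_eq_T_Int_p_elements: "S = T \<inter> p_elements G 2"
proof (intro equalityI subsetI)
  fix s assume s: "s \<in> S"
  have "S \<subseteq> T" using x_in_T T_subgroup by (intro generate_subgroup_incl) auto
  moreover have "ord s dvd 2 ^ a" using ord_dvd_card_subgroup[OF S_subgroup s] card_S by simp
  then have "ord s \<in> range ((^) 2)" by (auto simp: divides_primepow_nat)
  ultimately show "s \<in> T \<inter> p_elements G 2"
    using s T_carrier by (auto simp: p_elements_def)
next
  fix s assume "s \<in> T \<inter> p_elements G 2"
  then obtain k j where k: "s = t [^] (k::nat)" and j: "ord s = 2 ^ j"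
    by (auto simp: mem_T_iff p_elements_def)
  have "s [^] ord t = \<one>" using t_carrier by (simp add: k nat_pow_pow pow_eq_id)
  then have "2 ^ j dvd 2 ^ a * m" using t_carrier by (simp add: pow_eq_id k ord_t flip: j)
  then have "2 ^ j dvd (2::nat) ^ a"
    using odd_m by (simp add: coprime_dvd_mult_left_iff)
  then have "s [^] ((2::nat) ^ a) = \<one>" using t_carrier j by (simp add: pow_eq_id k)
  then have "2 ^ a * m dvd k * 2 ^ a"
    using t_carrier by (simp add: k nat_pow_pow pow_eq_id flip: ord_t)
  then have "m dvd k" by (simp add: mult.commute)
  then obtain l where "k = m * l" by (rule dvdE)
  then have "s = x [^] l" using t_carrier by (simp add: k x_def nat_pow_pow)
  then show "s \<in> S" using generate_pow_on_finite_carrier[OF finite_carrier x_carrier] by blast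
qed

lemma S_subset_Sylow:
  assumes P: "P \<in> Sylow_subgroups G 2" "x \<in> P"
  shows "S \<subseteq> P"
  using P Sylow_subgroup by (intro generate_subgroup_incl) auto

lemma outside_S_mult_closed:
  assumes P: "P \<in> Sylow_subgroups G 2" "x \<in> P"
    and u: "u \<in> P" "u \<notin> S" and v: "v \<in> P" "v \<notin> S"
  shows "u \<otimes> v \<in> S"
proof (rule index_two_mult_closed[OF S_subgroup Sylow_subgroup[OF P(1)] S_subset_Sylow[OF P]
      Sylow_finite[OF P(1)] _ u v])
  show "card P = 2 * card S"
    by (simp add: Sylow_card[OF P(1)] multiplicity_order card_S flip: a_def)
qed

lemma ex_outside_S:
  assumes P: "P \<in> Sylow_subgroups G 2"
  obtains w where "w \<in> P" "w \<notin> S"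
proof -
  have "card S < card P" by (simp add: Sylow_card[OF P] multiplicity_order card_S flip: a_def)
  moreover have "finite S"
    using S_subgroup finite_carrier subgroup.subset finite_subset by blast
  ultimately have "\<not> P \<subseteq> S" using card_mono by (metis not_less)
  then show ?thesis using that by blast
qed

lemma outside_S_not_in_T:
  assumes "P \<in> Sylow_subgroups G 2" "w \<in> P" "w \<notin> S"
  shows "w \<notin> T"
  using assms S_eq_T_Int_p_elements Sylow_subset_p_elements by blast

lemma outside_S_inverts_x:
  assumes P: "P \<in> Sylow_subgroups G 2" "x \<in> P" and w: "w \<in> P" "w \<notin> S"
  shows "conj_by w x = inv x"
proof -
  have w_carrier: "w \<in> carrier G" using w(1) Sylow_subset_carrier[OF P(1)] by blast
  have "w \<otimes> x \<notin> S"
  proof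
    assume "w \<otimes> x \<in> S"
    then have "w \<otimes> x \<otimes> inv x \<in> S"
      using x_in_S subgroup.m_closed[OF S_subgroup] subgroup.m_inv_closed[OF S_subgroup] by blast
    then show False using w w_carrier x_carrier by (simp add: m_assoc)
  qed
  moreover have "inv w \<notin> S"
    using w(2) w_carrier subgroup.m_inv_closed[OF S_subgroup, of "inv w"] by auto
  moreover have "w \<otimes> x \<in> P" "inv w \<in> P"
    using P w subgroup.m_closed subgroup.m_inv_closed Sylow_subgroup by metis+
  ultimately have "conj_by w x \<in> S" using outside_S_mult_closed[OF P] by blast
  then have "conj_by w x \<in> {x, inv x}"
    using fusion_inverts[OF x_in_T x_noncentral w_carrier] S_eq_T_Int_p_elements by blast
  moreover have "conj_by w x \<noteq> x"
    using centralizer_subset[OF x_in_T x_noncentral w_carrier]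
      conj_by_eq_iff_commute[OF w_carrier x_carrier] outside_S_not_in_T[OF P(1) w] by blast
  ultimately show ?thesis by blast
qed

lemma outside_S_inverts_T:
  assumes P: "P \<in> Sylow_subgroups G 2" "x \<in> P" and w: "w \<in> P" "w \<notin> S"
    and s: "s \<in> T" "s \<notin> {\<one>, z}"
  shows "conj_by w s = inv s"
proof -
  have w_carrier: "w \<in> carrier G" using w(1) Sylow_subset_carrier[OF P(1)] by blast
  have s_carrier: "s \<in> carrier G" using s(1) by (rule T_carrier)
  interpret conj: group_hom G G "conj_by w" by (rule conj_by_group_hom[OF w_carrier])
  have "conj_by w s \<otimes> conj_by w x = conj_by w x \<otimes> conj_by w s"
    using T_commute[OF s(1) x_in_T] s_carrier x_carrier by (metis conj.hom_mult)
  then have "conj_by w s \<otimes> inv x = inv x \<otimes> conj_by w s"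
    by (simp only: outside_S_inverts_x[OF P w])
  moreover have "inv x \<in> T" using x_in_T by (rule subgroup.m_inv_closed[OF T_subgroup])
  moreover have "inv x \<notin> {\<one>, z}"
    using x_noncentral inv_equality[OF z_square z_carrier z_carrier] inv_inv[OF x_carrier] x_carrier
    by auto
  ultimately have "conj_by w s \<in> T"
    using centralizer_subset[of "inv x" "conj_by w s"] w_carrier s_carrier by blast
  then have "conj_by w s \<in> {s, inv s}" using fusion_inverts[OF s w_carrier] by blast
  moreover have "conj_by w s \<noteq> s"
    using centralizer_subset[OF s w_carrier] conj_by_eq_iff_commute[OF w_carrier s_carrier]
      outside_S_not_in_T[OF P(1) w] by blast
  ultimately show ?thesis by blast
qed

lemma Sylow_eq_centralize_or_invert:
  assumes "m = 1" and P: "P \<in> Sylow_subgroups G 2" "x \<in> P"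
  shows "P = {g \<in> carrier G. conj_by g x \<in> {x, inv x}}"
proof (intro equalityI subsetI)
  have T_eq: "T = S" using \<open>m = 1\<close> t_carrier by (simp add: x_def)
  {
    fix g assume g: "g \<in> P"
    have "conj_by g x = x" if "g \<in> S" using that T_eq T_centralizes_x by blast
    moreover have "conj_by g x = inv x" if "g \<notin> S" by (rule outside_S_inverts_x[OF P g that])
    ultimately show "g \<in> {g \<in> carrier G. conj_by g x \<in> {x, inv x}}"
      using g Sylow_subset_carrier[OF P(1)] by blast
  }
  have centralizer: "g \<in> P" if "g \<in> carrier G" "conj_by g x = x" for g
    using that centralizer_subset[OF x_in_T x_noncentral] S_subset_Sylow[OF P] T_eq
    by (auto simp: conj_by_eq_iff_commute x_carrier)
  have inverter: "g \<in> P" if g: "g \<in> carrier G" "conj_by g x = inv x" for g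
  proof -
    obtain w where w: "w \<in> P" "w \<notin> S" using ex_outside_S[OF P(1)] by blast
    have w_carrier: "w \<in> carrier G" using w(1) Sylow_subset_carrier[OF P(1)] by blast
    have "conj_by (inv w) (conj_by g x) = x"
      using g(2) outside_S_inverts_x[OF P w] conj_by_inv_cancel(1)[OF w_carrier x_carrier] by simp
    then have "inv w \<otimes> g \<in> P"
      using conj_by_mult[of "inv w" g x] w_carrier g(1) x_carrier by (intro centralizer) auto
    then have "w \<otimes> (inv w \<otimes> g) \<in> P"
      using w(1) subgroup.m_closed[OF Sylow_subgroup[OF P(1)]] by blast
    then show "g \<in> P" using w_carrier g(1) by (simp flip: m_assoc)
  qed
  show "g \<in> P" if "g \<in> {g \<in> carrier G. conj_by g x \<in> {x, inv x}}" for g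
    using that centralizer inverter by blast
qed

lemma x_in_unique_Sylow:
  assumes "m = 1"
  shows "in_unique_Sylow G 2 x"
proof -
  obtain P where P: "P \<in> Sylow_subgroups G 2" "x \<in> P"
    using p_element_in_Sylow[OF x_p_element] by blast
  have "Q = P" if "Q \<in> Sylow_subgroups G 2" "x \<in> Q" for Q
    using Sylow_eq_centralize_or_invert[OF assms that] Sylow_eq_centralize_or_invert[OF assms P]
    by (rule trans[OF _ sym])
  then show ?thesis using P unfolding in_unique_Sylow_def by blast
qed

lemma x_not_in_unique_Sylow:
  assumes "m \<noteq> 1"
  shows "\<not> in_unique_Sylow G 2 x"
proof
  assume unique: "in_unique_Sylow G 2 x"
  then obtain P where P: "P \<in> Sylow_subgroups G 2" "x \<in> P" unfolding in_unique_Sylow_def by blast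
  define r where "r = t [^] ((2::nat) ^ a)"
  have r_in_T: "r \<in> T" unfolding r_def mem_T_iff by blast
  have r_carrier: "r \<in> carrier G" using r_in_T by (rule T_carrier)
  have ord_r: "ord r = m" using ord_pow[OF t_carrier, of "2 ^ a"] ord_t by (simp add: r_def)
  have "x \<in> conj_by r ` P" using P(2) T_centralizes_x[OF r_in_T] by (metis imageI)
  then have conj_P: "conj_by r ` P = P"
    using unique P conj_by_Sylow[OF P(1) r_carrier] unfolding in_unique_Sylow_def by blast
  obtain w where w: "w \<in> P" "w \<notin> S" using ex_outside_S[OF P(1)] by blast
  have w_carrier: "w \<in> carrier G" using w(1) Sylow_subset_carrier[OF P(1)] by blast
  have "conj_by r w \<in> P" using w(1) conj_P by blast
  then have "conj_by r w \<otimes> inv w \<in> P"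
    using w(1) subgroup.m_closed subgroup.m_inv_closed Sylow_subgroup[OF P(1)] by metis
  moreover have "conj_by r w \<otimes> inv w = r \<otimes> r"
  proof -
    have "inv r \<in> T" using r_in_T by (rule subgroup.m_inv_closed[OF T_subgroup])
    moreover have "ord (inv r) \<noteq> 1" "ord (inv r) \<noteq> 2" using ord_r r_carrier odd_m \<open>m \<noteq> 1\<close> by auto
    then have "inv r \<notin> {\<one>, z}" using ord_z by auto
    ultimately have "conj_by w (inv r) = r"
      using outside_S_inverts_T[OF P w] r_carrier by fastforce
    then show ?thesis using r_carrier w_carrier by (simp add: m_assoc)
  qed
  ultimately have "r \<otimes> r \<in> p_elements G 2" using Sylow_subset_p_elements[OF P(1)] by auto
  then obtain n where "ord (r [^] (2::nat)) = 2 ^ n"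
    using r_carrier by (auto simp: p_elements_def numeral_2_eq_2)
  moreover have "ord (r [^] (2::nat)) = m"
    using odd_m by (simp add: ord_pow_gen[OF r_carrier] ord_r)
  ultimately show False using odd_m \<open>m \<noteq> 1\<close> by (cases n) auto
qed

lemma exists_square_eq_z_in_S:
  obtains v where "v \<in> S" "v \<otimes> v = z"
proof -
  define v where "v = x [^] ((2::nat) ^ (a - 2))"
  have v_carrier: "v \<in> carrier G" using x_carrier by (simp add: v_def)
  have "ord v = 2 ^ a div 2 ^ (a - 2)"
    unfolding v_def by (subst ord_pow[OF x_carrier]) (auto simp: ord_x le_imp_power_dvd)
  also have "\<dots> = 4" using a_ge_2 by (simp flip: power_diff)
  finally have ord_v: "ord v = 4" .
  have "v \<otimes> v = v [^] (2::nat)" "(v \<otimes> v) \<otimes> (v \<otimes> v) = v [^] (4::nat)"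
    using v_carrier by (simp_all add: numeral_eq_Suc m_assoc)
  then have "v \<otimes> v \<noteq> \<one>" "(v \<otimes> v) \<otimes> (v \<otimes> v) = \<one>" using v_carrier ord_v by (simp_all add: pow_eq_id)
  then have "v \<otimes> v = z" using square_eq_one[of "v \<otimes> v"] v_carrier by blast
  moreover have "v \<in> S"
    using generate_pow_on_finite_carrier[OF finite_carrier x_carrier] by (auto simp: v_def)
  ultimately show ?thesis using that by blast
qed

lemma outside_S_square:
  assumes P: "P \<in> Sylow_subgroups G 2" "x \<in> P" and w: "w \<in> P" "w \<notin> S"
  shows "w \<otimes> w = z"
proof -
  have w_carrier: "w \<in> carrier G" using w(1) Sylow_subset_carrier[OF P(1)] by blast
  obtain v where "v \<in> S" "v \<otimes> v = z" by (rule exists_square_eq_z_in_S)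
  then have "z \<in> S" using subgroup.m_closed[OF S_subgroup] by blast
  then have "w \<otimes> w \<noteq> \<one>"
    using square_eq_one[OF w_carrier] w(2) subgroup.one_closed[OF S_subgroup] by blast
  moreover have "w \<otimes> w \<in> T" using outside_S_mult_closed[OF P w w] S_eq_T_Int_p_elements by blast
  then have "w \<otimes> w \<in> {\<one>, z}"
    using centralizer_subset[of "w \<otimes> w" w] outside_S_not_in_T[OF P(1) w] w_carrier
    by (auto simp: m_assoc)
  ultimately show ?thesis by blast
qed

lemma p_element_conj_into_S:
  assumes y: "y \<in> p_elements G 2"
  obtains g s where "g \<in> carrier G" "s \<in> S" "y = conj_by g s"
proof -
  obtain P where P: "P \<in> Sylow_subgroups G 2" "x \<in> P"
    using p_element_in_Sylow[OF x_p_element] by blast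
  obtain Q where Q: "Q \<in> Sylow_subgroups G 2" "y \<in> Q" using p_element_in_Sylow[OF y] by blast
  obtain g where g: "g \<in> carrier G" "Q = conj_by g ` P" using Sylow_conj[OF P(1) Q(1)] by blast
  then obtain w where w: "w \<in> P" "y = conj_by g w" using Q(2) by blast
  have w_carrier: "w \<in> carrier G" using w(1) Sylow_subset_carrier[OF P(1)] by blast
  show ?thesis
  proof (cases "w \<in> S")
    case True
    then show ?thesis using that g(1) w(2) by blast
  next
    case False
    obtain v where v: "v \<in> S" "v \<otimes> v = z" by (rule exists_square_eq_z_in_S)
    have v_carrier: "v \<in> carrier G" by (rule subgroup.mem_carrier[OF S_subgroup v(1)])
    obtain k where k: "k \<in> carrier G" "w = conj_by k v"
      using square_eq_z[OF v_carrier w_carrier v(2) outside_S_square[OF P w(1) False]] by blast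
    then have "y = conj_by (g \<otimes> k) v" using conj_by_mult[OF g(1) k(1) v_carrier] w(2) by simp
    then show ?thesis using that g(1) k(1) v(1) by blast
  qed
qed

theorem has_redundant_Sylow_two_iff:
  "has_redundant_Sylow G 2 \<longleftrightarrow> \<not> (\<exists>n. ord t = 2 ^ n)"
proof -
  have "has_redundant_Sylow G 2 \<longleftrightarrow> \<not> in_unique_Sylow G 2 x"
  proof
    assume "has_redundant_Sylow G 2"
    then show "\<not> in_unique_Sylow G 2 x" using x_p_element has_redundant_Sylow_iff by blast
  next
    assume not_unique: "\<not> in_unique_Sylow G 2 x"
    have "\<not> in_unique_Sylow G 2 y" if p_element: "y \<in> p_elements G 2" for y
    proof
      assume y: "in_unique_Sylow G 2 y"
      obtain g s where g: "g \<in> carrier G" and s: "s \<in> S" and y_eq: "y = conj_by g s"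
        using p_element_conj_into_S[OF p_element] by blast
      have s_carrier: "s \<in> carrier G" by (rule subgroup.mem_carrier[OF S_subgroup s])
      have "conj_by (inv g) y = s" using conj_by_inv_cancel(1)[OF g s_carrier] by (simp only: y_eq)
      then have "in_unique_Sylow G 2 s"
        using in_unique_Sylow_conj_by[OF _ _ y, of "inv g"] g s_carrier y_eq by simp
      then show False using in_unique_Sylow_if_in_generate[OF x_p_element s] not_unique by blast
    qed
    then show "has_redundant_Sylow G 2" by (simp add: has_redundant_Sylow_iff)
  qed
  also have "\<dots> \<longleftrightarrow> m \<noteq> 1" using x_in_unique_Sylow x_not_in_unique_Sylow by blast
  also have "\<dots> \<longleftrightarrow> \<not> (\<exists>n. ord t = 2 ^ n)"
  proof -
    have "m = 1" if "ord t = 2 ^ n" for n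
    proof -
      have "m dvd 2 ^ n" using that ord_t by (metis dvd_triv_right)
      then obtain j where "m = 2 ^ j" by (auto simp: divides_primepow_nat)
      then show ?thesis using odd_m by (cases j) auto
    qed
    moreover have "ord t = 2 ^ a" if "m = 1" using that ord_t by simp
    ultimately show ?thesis by blast
  qed
  finally show ?thesis .
qed

end

section \<open>Finite fields\<close>

lemma two_le_CARD_field: "2 \<le> CARD('a::{field,finite})"
proof -
  have "card {0, 1 :: 'a} \<le> CARD('a)" by (rule card_mono) auto
  then show ?thesis by simp
qed

lemma four_eq_zero_iff: "(4 :: 'a::idom) = 0 \<longleftrightarrow> (2 :: 'a) = 0"
proof -
  have "(4 :: 'a) = 2 * 2" by simp
  then show ?thesis by (simp only: mult_eq_0_iff disj_absorb)
qed

lemma square_surj_if_two_eq_zero: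
  assumes "(2 :: 'a::{field,finite}) = 0"
  shows "\<exists>x :: 'a. x * x = d"
proof -
  have "- x = x" for x :: 'a
    using assms mult_2[of x] by (simp add: eq_neg_iff_add_eq_0 neg_eq_iff_add_eq_0)
  then have "inj (\<lambda>x :: 'a. x * x)" by (auto simp: inj_def square_eq_iff)
  then have "surj (\<lambda>x :: 'a. x * x)" by (rule finite_UNIV_inj_surj[OF finite])
  then obtain x where "d = x * x" by (rule surjE)
  then show ?thesis by blast
qed

lemma CARD_less_double_card_squares:
  "CARD('a::{field,finite}) < 2 * card (range (\<lambda>x :: 'a. x * x))"
proof -
  let ?S = "range (\<lambda>x :: 'a. x * x)"
  define root where "root = inv_into UNIV (\<lambda>x :: 'a. x * x)"
  have root: "root (x * x) * root (x * x) = x * x" for x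
    unfolding root_def by (rule f_inv_into_f) blast
  have "x \<in> root ` ?S \<union> (\<lambda>s. - root s) ` (?S - {0})" for x
  proof -
    have "x = root (x * x) \<or> x = - root (x * x)" using root[of x] square_eq_iff by metis
    then consider "x = root (x * x)" | "x = - root (x * x)" "x \<noteq> 0" using root[of 0] by fastforce
    then show ?thesis by cases (blast, auto)
  qed
  then have "CARD('a) \<le> card (root ` ?S \<union> (\<lambda>s. - root s) ` (?S - {0}))"
    by (intro card_mono) auto
  also have "\<dots> \<le> card ?S + card (?S - {0})"
    by (intro order.trans[OF card_Un_le] add_mono card_image_le) auto
  also have "\<dots> < card ?S + card ?S"
    by (intro add_strict_left_mono psubset_card_mono) (auto simp: image_iff intro!: exI[of _ 0])
  finally show ?thesis by simp
qed

lemma sum_scaled_squares_surj: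
  fixes \<alpha> \<beta> d :: "'a::{field,finite}"
  assumes "\<alpha> \<noteq> 0" "\<beta> \<noteq> 0"
  shows "\<exists>x y. \<alpha> * (x * x) + \<beta> * (y * y) = d"
proof -
  let ?S = "range (\<lambda>x :: 'a. x * x)"
  let ?A = "(\<lambda>s. \<alpha> * s) ` ?S" and ?B = "(\<lambda>s. d - \<beta> * s) ` ?S"
  have "card ?A = card ?S" "card ?B = card ?S"
    using assms by (auto intro!: card_image inj_onI)
  then have "CARD('a) < card ?A + card ?B"
    using CARD_less_double_card_squares[where 'a = 'a] by simp
  also have "\<dots> = card (?A \<union> ?B) + card (?A \<inter> ?B)" by (intro card_Un_Int) auto
  finally have "?A \<inter> ?B \<noteq> {}" using card_mono[of "UNIV :: 'a set" "?A \<union> ?B"] by fastforce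
  then obtain x y where "\<alpha> * (x * x) = d - \<beta> * (y * y)" by blast
  then have "\<alpha> * (x * x) + \<beta> * (y * y) = d" by simp
  then show ?thesis by blast
qed

lemma binary_quadratic_form_surj:
  fixes \<alpha> \<beta> \<gamma> d :: "'a::{field,finite}"
  assumes disc: "\<beta> * \<beta> \<noteq> 4 * \<alpha> * \<gamma>"
  shows "\<exists>x y. \<alpha> * (x * x) + \<beta> * (x * y) + \<gamma> * (y * y) = d"
proof -
  consider (linear) "\<alpha> = 0" | (even) "\<alpha> \<noteq> 0" "(2 :: 'a) = 0"
    | (odd) "\<alpha> \<noteq> 0" "(2 :: 'a) \<noteq> 0" by blast
  then show ?thesis
  proof cases
    case linear
    then have "\<alpha> * (((d - \<gamma>) / \<beta>) * ((d - \<gamma>) / \<beta>)) + \<beta> * (((d - \<gamma>) / \<beta>) * 1) + \<gamma> * (1 * 1) = d"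
      using disc by simp
    then show ?thesis by blast
  next
    case even
    obtain x where "x * x = d / \<alpha>" using square_surj_if_two_eq_zero[OF even(2)] by blast
    then have "\<alpha> * (x * x) + \<beta> * (x * 0) + \<gamma> * (0 * 0) = d" using even(1) by simp
    then show ?thesis by blast
  next
    case odd
    have "4 * \<alpha> * \<gamma> - \<beta> * \<beta> \<noteq> 0" using disc by simp
    from sum_scaled_squares_surj[OF one_neq_zero this]
    obtain u y where uy: "1 * (u * u) + (4 * \<alpha> * \<gamma> - \<beta> * \<beta>) * (y * y) = 4 * \<alpha> * d"
      by blast
    define x where "x = (u - \<beta> * y) / (2 * \<alpha>)"
    have u: "u = 2 * \<alpha> * x + \<beta> * y" using odd by (simp add: x_def)
    have "4 * \<alpha> * (\<alpha> * (x * x) + \<beta> * (x * y) + \<gamma> * (y * y)) = 4 * \<alpha> * d"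
      using uy unfolding u by (simp add: algebra_simps)
    then show ?thesis using odd four_eq_zero_iff[where 'a = 'a] by auto
  qed
qed

lemma irreducible_quadratic_exists: "\<exists>c :: 'a::{field,finite}. \<forall>x. x * x + x \<noteq> c"
proof -
  have "\<not> inj (\<lambda>x :: 'a. x * x + x)"
  proof
    assume "inj (\<lambda>x :: 'a. x * x + x)"
    then have "(-1 :: 'a) = 0" by (rule injD) simp
    then show False by simp
  qed
  then have "\<not> surj (\<lambda>x :: 'a. x * x + x)" using finite_UNIV_surj_inj[OF finite] by blast
  then show ?thesis unfolding surj_def by metis
qed

lemma (in field) mult_of_eq_generate:
  assumes "finite (carrier R)"
  obtains g where "g \<in> carrier (mult_of R)" "generate (mult_of R) {g} = carrier (mult_of R)"
proof -
  interpret M: group "mult_of R" by (rule field_mult_group)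
  obtain g where g: "g \<in> carrier (mult_of R)" "carrier (mult_of R) = {g [^] i | i::nat. i \<in> UNIV}"
    using finite_field_mult_group_has_gen[OF assms] by blast
  then have "generate (mult_of R) {g} = carrier (mult_of R)"
    using M.generate_pow_on_finite_carrier[OF finite_mult_of[OF assms] g(1)]
    by (simp add: nat_pow_mult_of)
  then show ?thesis using that g(1) by blast
qed

section \<open>The group SL(2,F)\<close>

type_synonym 'a mat2 = "'a \<times> 'a \<times> 'a \<times> 'a"

lemma mem_SL2 [simp]: "(a, b, c, d) \<in> carrier SL2 \<longleftrightarrow> a * d - b * c = 1"
  by (simp add: SL2_def)

lemma mult_SL2 [simp]:
  "(a, b, c, d) \<otimes>\<^bsub>SL2\<^esub> (a', b', c', d') =
     (a * a' + b * c', a * b' + b * d', c * a' + d * c', c * b' + d * d')"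
  by (simp add: SL2_def mat2_mult_def)

lemma one_SL2: "\<one>\<^bsub>SL2\<^esub> = (1, 0, 0, 1)"
  by (simp add: SL2_def)

lemma group_SL2: "group (SL2 :: 'a::field mat2 monoid)"
proof (rule groupI)
  fix x y z :: "'a mat2"
  assume x: "x \<in> carrier SL2"
  obtain a b c d where x_eq: "x = (a, b, c, d)" by (cases x)
  obtain a' b' c' d' where y_eq: "y = (a', b', c', d')" by (cases y)
  obtain a'' b'' c'' d'' where z_eq: "z = (a'', b'', c'', d'')" by (cases z)
  have det_x: "a * d - b * c = 1" using x x_eq by simp
  show "x \<otimes>\<^bsub>SL2\<^esub> y \<otimes>\<^bsub>SL2\<^esub> z = x \<otimes>\<^bsub>SL2\<^esub> (y \<otimes>\<^bsub>SL2\<^esub> z)"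
    by (simp add: x_eq y_eq z_eq algebra_simps)
  show "\<one>\<^bsub>SL2\<^esub> \<otimes>\<^bsub>SL2\<^esub> x = x" by (simp add: x_eq one_SL2)
  show "\<exists>y\<in>carrier SL2. y \<otimes>\<^bsub>SL2\<^esub> x = \<one>\<^bsub>SL2\<^esub>"
    by (rule bexI[of _ "(d, -b, -c, a)"]) (use det_x in \<open>auto simp: x_eq one_SL2 algebra_simps\<close>)
  assume y: "y \<in> carrier SL2"
  then have "(a * d - b * c) * (a' * d' - b' * c') = 1" using det_x y_eq by simp
  then show "x \<otimes>\<^bsub>SL2\<^esub> y \<in> carrier SL2" by (simp add: x_eq y_eq algebra_simps)
qed (simp add: one_SL2)

interpretation SL2: group "SL2 :: 'a::field mat2 monoid"
  by (rule group_SL2)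

lemma inv_SL2:
  assumes "a * d - b * c = 1"
  shows "inv\<^bsub>SL2\<^esub> (a, b, c, d) = (d, -b, -c, a)"
  using assms by (intro SL2.inv_equality) (auto simp: one_SL2 algebra_simps)

lemma finite_SL2: "finite (carrier (SL2 :: 'a::{field,finite} mat2 monoid))"
  by (rule finite_subset[OF subset_UNIV finite])

lemma carrier_SL2_eq:
  "carrier (SL2 :: 'a::field mat2 monoid) =
     (\<lambda>(a, b, c). (a, b, c, (1 + b * c) / a)) ` ((UNIV - {0}) \<times> UNIV \<times> UNIV) \<union>
     (\<lambda>(b, d). (0, b, - 1 / b, d)) ` ((UNIV - {0}) \<times> UNIV)" (is "_ = ?A \<union> ?B")
proof (intro equalityI subsetI)
  fix x :: "'a mat2"
  assume "x \<in> carrier SL2"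
  moreover obtain a b c d where x: "x = (a, b, c, d)" by (cases x)
  ultimately have det: "a * d - b * c = 1" by simp
  show "x \<in> ?A \<union> ?B"
  proof (cases "a = 0")
    case True
    then have bc: "b * (- c) = 1" using det by simp
    then have "b \<noteq> 0" by auto
    moreover have "c = - 1 / b" using inverse_unique[OF bc] by (simp add: divide_inverse)
    ultimately have "x \<in> ?B" using True by (intro image_eqI[of _ _ "(b, d)"]) (auto simp: x)
    then show ?thesis ..
  next
    case False
    then have "x \<in> ?A" using det by (intro image_eqI[of _ _ "(a, b, c)"]) (auto simp: x field_simps)
    then show ?thesis ..
  qed
qed (auto split: if_splits)

lemma order_SL2:
  "order (SL2 :: 'a::{field,finite} mat2 monoid) = CARD('a) * ((CARD('a) - 1) * (CARD('a) + 1))"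
proof -
  let ?q = "CARD('a)"
  let ?A = "(\<lambda>(a, b, c). (a, b, c, (1 + b * c) / a)) ` ((UNIV - {0 :: 'a}) \<times> UNIV \<times> UNIV)"
  let ?B = "(\<lambda>(b, d). (0, b, - 1 / b, d) :: 'a mat2) ` ((UNIV - {0}) \<times> UNIV)"
  have nonzero: "card (UNIV - {0 :: 'a}) = ?q - 1" by simp
  have "inj_on (\<lambda>(a, b, c). (a, b, c, (1 + b * c) / a)) ((UNIV - {0 :: 'a}) \<times> UNIV \<times> UNIV)"
    by (auto simp: inj_on_def)
  then have "card ?A = (?q - 1) * (?q * ?q)"
    by (subst card_image) (simp_all add: card_cartesian_product nonzero del: UNIV_Times_UNIV)
  moreover have "inj_on (\<lambda>(b, d). (0, b, - 1 / b, d) :: 'a mat2) ((UNIV - {0}) \<times> UNIV)"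
    by (auto simp: inj_on_def)
  then have "card ?B = (?q - 1) * ?q"
    by (subst card_image) (simp_all add: card_cartesian_product nonzero)
  moreover have "card (?A \<union> ?B) = card ?A + card ?B"
    by (intro card_Un_disjoint) auto
  ultimately show ?thesis
    by (simp only: order_def carrier_SL2_eq) (simp add: algebra_simps)
qed

lemma multiplicity_order_SL2:
  assumes p: "prime p" and not_dvd: "\<not> p dvd CARD('a::{field,finite})"
  shows "multiplicity p (order (SL2 :: 'a mat2 monoid)) =
    multiplicity p (CARD('a) - 1) + multiplicity p (CARD('a) + 1)"
proof -
  have "CARD('a) - 1 \<noteq> 0" using two_le_CARD_field[where 'a = 'a] by simp
  then show ?thesis
    using p not_dvd
    by (simp add: order_SL2 prime_elem_multiplicity_mult_distrib not_dvd_imp_multiplicity_0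
        del: mult_Suc mult_Suc_right)
qed

definition trace2 :: "'a::field mat2 \<Rightarrow> 'a" where
  "trace2 M = (case M of (a, b, c, d) \<Rightarrow> a + d)"

lemma trace2_Pair [simp]: "trace2 (a, b, c, d) = a + d"
  by (simp add: trace2_def)

lemma trace2_mult_commute: "trace2 (M \<otimes>\<^bsub>SL2\<^esub> N) = trace2 (N \<otimes>\<^bsub>SL2\<^esub> M)"
  by (cases M, cases N) (simp add: algebra_simps)

lemma trace2_conj_by:
  assumes "g \<in> carrier SL2" "s \<in> carrier SL2"
  shows "trace2 (SL2.conj_by g s) = trace2 s"
proof -
  have "trace2 (SL2.conj_by g s) = trace2 (inv\<^bsub>SL2\<^esub> g \<otimes>\<^bsub>SL2\<^esub> (g \<otimes>\<^bsub>SL2\<^esub> s))"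
    by (rule trace2_mult_commute)
  then show ?thesis using assms by (simp flip: SL2.m_assoc)
qed

lemma square_eq_one_SL2:
  assumes two: "(2 :: 'a::field) \<noteq> 0" and y: "y \<in> carrier (SL2 :: 'a mat2 monoid)"
    and square: "y \<otimes>\<^bsub>SL2\<^esub> y = \<one>\<^bsub>SL2\<^esub>"
  shows "y \<in> {\<one>\<^bsub>SL2\<^esub>, (-1, 0, 0, -1)}"
proof -
  obtain a b c d where y_eq: "y = (a, b, c, d)" by (cases y)
  have det: "a * d - b * c = 1" using y y_eq by simp
  have "(d, - b, - c, a) = (a, b, c, d)"
    using SL2.inv_equality[OF square y y] unfolding y_eq inv_SL2[OF det] .
  then have entries: "d = a" "- b = b" "- c = c" unfolding prod.inject by iprover+
  then have "2 * b = 0" "2 * c = 0" by (metis add.right_inverse mult_2)+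
  then have "b = 0" "c = 0" using two by simp_all
  moreover from this have "a = 1 \<or> a = -1" using det entries(1) square_eq_1_iff[of a] by simp
  ultimately show ?thesis using entries(1) by (auto simp: y_eq one_SL2)
qed

lemma trace2_eq_zero_if_square_eq_minus_one:
  assumes y: "y \<in> carrier SL2" and square: "y \<otimes>\<^bsub>SL2\<^esub> y = (-1, 0, 0, -1)"
  shows "trace2 y = 0"
proof (rule ccontr)
  obtain a b c d where y_eq: "y = (a, b, c, d)" by (cases y)
  assume "trace2 y \<noteq> 0"
  then have trace: "a + d \<noteq> 0" by (simp add: y_eq)
  have det: "a * d - b * c = 1" using y y_eq by simp
  have entries: "a * a + b * c = -1" "a * b + b * d = 0"
    using square by (auto simp: y_eq)
  have "a * (a + d) = (a * a + b * c) + (a * d - b * c)" by (simp add: algebra_simps)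
  then have "a * (a + d) = 0" "b * (a + d) = 0" using entries det by (simp_all add: algebra_simps)
  then show False using trace det by simp
qed

text \<open>The change of basis matrix has columns \<open>v\<close> and \<open>y v\<close>, where \<open>v\<close> is chosen so that its
  determinant, a binary quadratic form in \<open>v\<close> of discriminant \<open>\<tau>\<^sup>2 - 4\<close>, takes the value 1.\<close>
lemma conj_companion_matrix:
  fixes y :: "'a::{field,finite} mat2"
  assumes y: "y \<in> carrier SL2" and trace: "trace2 y = \<tau>" "\<tau> * \<tau> \<noteq> 4"
  shows "\<exists>g\<in>carrier SL2. y = SL2.conj_by g (0, -1, 1, \<tau>)"
proof -
  obtain a b c d where y_eq: "y = (a, b, c, d)" by (cases y)
  have det: "a * d - b * c = 1" using y y_eq by simp
  have \<tau>: "\<tau> = a + d" using trace(1) y_eq by simp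
  have "(d - a) * (d - a) = \<tau> * \<tau> - 4 * (a * d - b * c) - 4 * c * b"
    by (simp add: \<tau> algebra_simps)
  then have "(d - a) * (d - a) \<noteq> 4 * c * (- b)" using trace(2) det by simp
  from binary_quadratic_form_surj[OF this]
  obtain v w where vw: "c * (v * v) + (d - a) * (v * w) + (- b) * (w * w) = 1" by blast
  define g where "g = (v, a * v + b * w, w, c * v + d * w)"
  have g: "g \<in> carrier SL2" using vw by (simp add: g_def algebra_simps)
  have "a * (a * v + b * w) + b * (c * v + d * w) = \<tau> * (a * v + b * w) - (a * d - b * c) * v"
    "c * (a * v + b * w) + d * (c * v + d * w) = \<tau> * (c * v + d * w) - (a * d - b * c) * w"
    by (simp_all add: \<tau> algebra_simps)
  then have "y \<otimes>\<^bsub>SL2\<^esub> g = g \<otimes>\<^bsub>SL2\<^esub> (0, -1, 1, \<tau>)"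
    by (simp add: y_eq g_def det mult.commute[of \<tau>])
  then have "y = SL2.conj_by g (0, -1, 1, \<tau>)"
    using y g by (metis SL2.inv_closed SL2.inv_solve_right SL2.m_closed)
  then show ?thesis using g by blast
qed

lemma conj_if_trace2_eq:
  fixes y y' :: "'a::{field,finite} mat2"
  assumes y: "y \<in> carrier SL2" "y' \<in> carrier SL2"
    and trace: "trace2 y' = trace2 y" "trace2 y * trace2 y \<noteq> 4"
  shows "\<exists>g\<in>carrier SL2. y' = SL2.conj_by g y"
proof -
  define \<tau> where "\<tau> = trace2 y"
  let ?J = "(0, -1, 1, \<tau>)"
  have J: "?J \<in> carrier SL2" by simp
  have traces: "trace2 y = \<tau>" "trace2 y' = \<tau>" "\<tau> * \<tau> \<noteq> 4" using trace by (simp_all add: \<tau>_def)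
  obtain g where g: "g \<in> carrier SL2" "y = SL2.conj_by g ?J"
    using conj_companion_matrix[OF y(1) traces(1,3)] by blast
  obtain h where h: "h \<in> carrier SL2" "y' = SL2.conj_by h ?J"
    using conj_companion_matrix[OF y(2) traces(2,3)] by blast
  have "SL2.conj_by (inv\<^bsub>SL2\<^esub> g) y = ?J"
    unfolding g(2) by (rule SL2.conj_by_inv_cancel(1)[OF g(1) J])
  then have "y' = SL2.conj_by (h \<otimes>\<^bsub>SL2\<^esub> inv\<^bsub>SL2\<^esub> g) y"
    using SL2.conj_by_mult[OF h(1) SL2.inv_closed[OF g(1)] y(1)] h(2) by metis
  then show ?thesis using g(1) h(1) by blast
qed

section \<open>Quadratic algebras and tori\<close>

text \<open>The pair \<open>(a, b)\<close> stands for \<open>a + b \<theta>\<close> with \<open>\<theta>\<^sup>2 + \<theta> = c\<close>, and \<open>quad_mat c\<close> is the matrix of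
  multiplication by \<open>a + b \<theta>\<close> in the basis \<open>1, \<theta>\<close>. The discriminant of the algebra is \<open>1 + 4 c\<close>; in
  every characteristic it splits for \<open>c = 0\<close>.\<close>
definition quad_ext :: "'a::field \<Rightarrow> ('a \<times> 'a) ring" where
  "quad_ext c = \<lparr>carrier = UNIV,
     mult = (\<lambda>(a, b) (a', b'). (a * a' + c * b * b', a * b' + b * a' - b * b')),
     one = (1, 0), zero = (0, 0), add = (\<lambda>(a, b) (a', b'). (a + a', b + b'))\<rparr>"

definition quad_norm :: "'a::field \<Rightarrow> 'a \<times> 'a \<Rightarrow> 'a" where
  "quad_norm c u = (case u of (a, b) \<Rightarrow> a * a - a * b - c * b * b)"

definition quad_mat :: "'a::field \<Rightarrow> 'a \<times> 'a \<Rightarrow> 'a mat2" where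
  "quad_mat c u = (case u of (a, b) \<Rightarrow> (a, b * c, b, a - b))"

definition norm_torus :: "'a::field \<Rightarrow> 'a mat2 set" where
  "norm_torus c = quad_mat c ` {u. quad_norm c u = 1}"

lemma quad_ext_simps [simp]:
  "carrier (quad_ext c) = UNIV"
  "(a, b) \<otimes>\<^bsub>quad_ext c\<^esub> (a', b') = (a * a' + c * b * b', a * b' + b * a' - b * b')"
  "\<one>\<^bsub>quad_ext c\<^esub> = (1, 0)"
  "\<zero>\<^bsub>quad_ext c\<^esub> = (0, 0)"
  "(a, b) \<oplus>\<^bsub>quad_ext c\<^esub> (a', b') = (a + a', b + b')"
  by (simp_all add: quad_ext_def)

lemma quad_norm_Pair: "quad_norm c (a, b) = a * a - a * b - c * b * b"
  by (simp add: quad_norm_def)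

lemma quad_mat_Pair: "quad_mat c (a, b) = (a, b * c, b, a - b)"
  by (simp add: quad_mat_def)

lemma quad_norm_mult: "quad_norm c (u \<otimes>\<^bsub>quad_ext c\<^esub> v) = quad_norm c u * quad_norm c v"
  by (cases u, cases v) (simp add: quad_norm_Pair algebra_simps)

lemma quad_mat_mult: "quad_mat c u \<otimes>\<^bsub>SL2\<^esub> quad_mat c v = quad_mat c (u \<otimes>\<^bsub>quad_ext c\<^esub> v)"
  by (cases u, cases v) (simp add: quad_mat_Pair algebra_simps)

lemma quad_mat_pow: "quad_mat c u [^]\<^bsub>SL2\<^esub> n = quad_mat c (u [^]\<^bsub>quad_ext c\<^esub> n)" for n :: nat
  by (induction n) (simp_all add: one_SL2 quad_mat_mult quad_mat_Pair)

lemma quad_mat_in_SL2_iff: "quad_mat c u \<in> carrier SL2 \<longleftrightarrow> quad_norm c u = 1"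
  by (cases u) (simp add: quad_mat_Pair quad_norm_Pair algebra_simps)

lemma inj_quad_mat: "inj (quad_mat c)"
  by (auto simp: inj_def quad_mat_def)

lemma inv_quad_mat:
  assumes "quad_norm c (a, b) = 1"
  shows "inv\<^bsub>SL2\<^esub> (quad_mat c (a, b)) = quad_mat c (a - b, - b)"
proof -
  have "a * (a - b) - b * c * b = 1" using assms by (simp add: quad_norm_Pair algebra_simps)
  then show ?thesis by (simp add: inv_SL2 quad_mat_Pair)
qed

lemma norm_torus_subgroup: "subgroup (norm_torus c) SL2"
proof (rule SL2.subgroupI)
  show "norm_torus c \<subseteq> carrier SL2" by (auto simp: norm_torus_def quad_mat_in_SL2_iff)
  have "quad_norm c (1, 0) = 1" by (simp add: quad_norm_Pair)
  then show "norm_torus c \<noteq> {}" unfolding norm_torus_def by blast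
  fix s assume "s \<in> norm_torus c"
  then obtain a b where s: "s = quad_mat c (a, b)" "quad_norm c (a, b) = 1"
    by (auto simp: norm_torus_def)
  have "quad_norm c (a - b, - b) = 1" using s(2) by (simp add: quad_norm_Pair algebra_simps)
  then show "inv\<^bsub>SL2\<^esub> s \<in> norm_torus c" by (auto simp: norm_torus_def s(1) inv_quad_mat[OF s(2)])
next
  fix s s' assume "s \<in> norm_torus c" "s' \<in> norm_torus c"
  then obtain u v where "s = quad_mat c u" "quad_norm c u = 1" "s' = quad_mat c v"
    "quad_norm c v = 1"
    unfolding norm_torus_def by blast
  then show "s \<otimes>\<^bsub>SL2\<^esub> s' \<in> norm_torus c"
    by (simp add: norm_torus_def quad_mat_mult quad_norm_mult)
qed

lemma norm_torus_noncentral: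
  assumes "s \<in> norm_torus c" "s \<notin> SL2_centre"
  obtains a b where "s = quad_mat c (a, b)" "quad_norm c (a, b) = 1" "b \<noteq> 0"
proof -
  obtain a b where s: "s = quad_mat c (a, b)" "quad_norm c (a, b) = 1"
    using assms(1) by (auto simp: norm_torus_def)
  moreover have "b \<noteq> 0"
  proof
    assume "b = 0"
    then have "a = 1 \<or> a = -1" using s(2) square_eq_1_iff[of a] by (simp add: quad_norm_Pair)
    then show False using assms(2) s(1) \<open>b = 0\<close> by (auto simp: SL2_centre_def quad_mat_Pair)
  qed
  ultimately show ?thesis using that by blast
qed

lemma commute_quad_mat_imp_range:
  assumes "b \<noteq> 0" and comm: "g \<otimes>\<^bsub>SL2\<^esub> quad_mat c (a, b) = quad_mat c (a, b) \<otimes>\<^bsub>SL2\<^esub> g"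
  shows "g \<in> range (quad_mat c)"
proof -
  obtain x y w z where g: "g = (x, y, w, z)" by (cases g)
  have "b * (y - w * c) = 0" "b * (z - (x - w)) = 0"
    using comm by (simp_all add: g quad_mat_Pair algebra_simps)
  then have "g = quad_mat c (x, w)" using \<open>b \<noteq> 0\<close> by (simp add: g quad_mat_Pair)
  then show ?thesis by blast
qed

lemma quad_conjugate_if_trace_eq:
  assumes disc: "1 + 4 * c \<noteq> (0 :: 'a::field)"
    and norm: "quad_norm c (a, b) = 1" "quad_norm c (a', b') = 1"
    and trace: "2 * a - b = 2 * a' - b'"
  shows "(a', b') \<in> {(a, b), (a - b, - b)}"
proof -
  define e where "e = a - a'"
  have a': "a' = a - e" by (simp add: e_def)
  have b': "b' = b - 2 * e" using trace by (simp add: e_def algebra_simps)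
  have "e * ((e - b) * (1 + 4 * c)) = quad_norm c (a, b) - quad_norm c (a', b')"
    unfolding a' b' by (simp add: quad_norm_Pair algebra_simps)
  then have "e * (e - b) = 0" using norm disc by simp
  then have "e = 0 \<or> e = b" by auto
  then show ?thesis using a' b' by auto
qed

theorem rank_one_torus_norm_torus:
  assumes disc: "1 + 4 * c \<noteq> (0 :: 'a::field)"
  shows "rank_one_torus SL2 (norm_torus c) SL2_centre"
proof (intro rank_one_torus.intro rank_one_torus_axioms.intro group_SL2)
  show "subgroup (norm_torus c) SL2" by (rule norm_torus_subgroup)
  fix s g :: "'a mat2"
  assume s: "s \<in> norm_torus c" "s \<notin> SL2_centre" and g: "g \<in> carrier SL2"
  obtain a b where ab: "s = quad_mat c (a, b)" "quad_norm c (a, b) = 1" "b \<noteq> 0"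
    using norm_torus_noncentral[OF s] by blast
  show "g \<in> norm_torus c" if comm: "g \<otimes>\<^bsub>SL2\<^esub> s = s \<otimes>\<^bsub>SL2\<^esub> g"
  proof -
    have "g \<in> range (quad_mat c)" using commute_quad_mat_imp_range[OF ab(3)] comm ab(1) by blast
    then show ?thesis using g quad_mat_in_SL2_iff by (auto simp: norm_torus_def)
  qed
  show "SL2.conj_by g s \<in> {s, inv\<^bsub>SL2\<^esub> s}" if conj: "SL2.conj_by g s \<in> norm_torus c"
  proof -
    obtain a' b' where ab': "SL2.conj_by g s = quad_mat c (a', b')" "quad_norm c (a', b') = 1"
      using conj by (auto simp: norm_torus_def)
    have "s \<in> carrier SL2" using ab by (simp only: quad_mat_in_SL2_iff)
    then have "trace2 (quad_mat c (a', b')) = trace2 (quad_mat c (a, b))"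
      using trace2_conj_by[OF g] ab(1) ab'(1) by metis
    then have "(a', b') \<in> {(a, b), (a - b, - b)}"
      by (intro quad_conjugate_if_trace_eq[OF disc ab(2) ab'(2)])
        (simp add: quad_mat_Pair algebra_simps)
    then show ?thesis using ab ab' inv_quad_mat[OF ab(2)] by auto
  qed
qed

definition mult_group :: "'a::field monoid" where
  "mult_group = \<lparr>carrier = UNIV - {0}, mult = (*), one = 1\<rparr>"

lemma mult_group_simps [simp]:
  "carrier mult_group = UNIV - {0}" "x \<otimes>\<^bsub>mult_group\<^esub> y = x * y" "\<one>\<^bsub>mult_group\<^esub> = 1"
  by (simp_all add: mult_group_def)

lemma group_mult_group: "group (mult_group :: 'a::field monoid)"
proof (rule groupI)
  fix x :: 'a
  assume "x \<in> carrier mult_group"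
  then show "\<exists>y\<in>carrier mult_group. y \<otimes>\<^bsub>mult_group\<^esub> x = \<one>\<^bsub>mult_group\<^esub>"
    by (intro bexI[of _ "inverse x"]) auto
qed auto

lemma quad_norm_eq_0_iff:
  assumes irreducible: "\<forall>x. x * x + x \<noteq> c"
  shows "quad_norm c u = 0 \<longleftrightarrow> u = (0, 0)"
proof
  obtain a b where u: "u = (a, b)" by (cases u)
  assume norm: "quad_norm c u = 0"
  have "b = 0"
  proof (rule ccontr)
    assume "b \<noteq> 0"
    then have "(- (a / b)) * (- (a / b)) + (- (a / b)) = c"
      using norm by (simp add: u quad_norm_Pair field_simps)
    then show False using irreducible by blast
  qed
  then show "u = (0, 0)" using norm by (simp add: u quad_norm_Pair)
qed (simp add: quad_norm_Pair)

lemma field_quad_ext: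
  assumes irreducible: "\<forall>x. x * x + x \<noteq> c"
  shows "field (quad_ext c)"
proof -
  have "cring (quad_ext c)"
  proof (intro cringI abelian_groupI comm_monoidI)
    fix u :: "'a \<times> 'a"
    show "\<exists>v\<in>carrier (quad_ext c). v \<oplus>\<^bsub>quad_ext c\<^esub> u = \<zero>\<^bsub>quad_ext c\<^esub>"
      by (rule bexI[of _ "(- fst u, - snd u)"]) (cases u, auto)
  qed (auto simp: algebra_simps)
  then show ?thesis
  proof (rule cring.cring_fieldI2)
    fix u :: "'a \<times> 'a"
    assume u: "u \<noteq> \<zero>\<^bsub>quad_ext c\<^esub>"
    obtain a b where ab: "u = (a, b)" by (cases u)
    define n where "n = quad_norm c u"
    have n: "n \<noteq> 0" using u quad_norm_eq_0_iff[OF irreducible] by (simp add: n_def)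
    have "a * ((a - b) / n) + c * b * (- b / n) = (a * (a - b) - c * b * b) / n"
      using n by (simp add: field_simps)
    also have "a * (a - b) - c * b * b = n" by (simp add: n_def ab quad_norm_Pair algebra_simps)
    finally have "a * ((a - b) / n) + c * b * (- b / n) = 1" using n by simp
    moreover have "a * (- b / n) + b * ((a - b) / n) - b * (- b / n) = 0"
      using n by (simp add: field_simps)
    ultimately have "u \<otimes>\<^bsub>quad_ext c\<^esub> ((a - b) / n, - b / n) = \<one>\<^bsub>quad_ext c\<^esub>" by (simp add: ab)
    then show "\<exists>v\<in>carrier (quad_ext c). u \<otimes>\<^bsub>quad_ext c\<^esub> v = \<one>\<^bsub>quad_ext c\<^esub>"
      by (intro bexI[of _ "((a - b) / n, - b / n)"]) auto
  qed simp
qed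

lemma disc_nonzero_if_irreducible:
  fixes c :: "'a::field"
  assumes irreducible: "\<forall>x. x * x + x \<noteq> c"
  shows "1 + 4 * c \<noteq> 0"
proof
  assume disc: "1 + 4 * c = 0"
  then have "(4 :: 'a) \<noteq> 0" by auto
  then have two: "(2 :: 'a) \<noteq> 0" by (simp add: four_eq_zero_iff)
  define x :: 'a where "x = - (1 / 2)"
  have "(2 * x + 1) * (2 * x + 1) = 1 + 4 * (x * x + x)" by (simp add: algebra_simps)
  moreover have "2 * x + 1 = 0" using two by (simp add: x_def)
  ultimately have "4 * (x * x + x) = 4 * c" using disc by (metis add_left_cancel mult_zero_left)
  then have "x * x + x = c" using \<open>4 \<noteq> 0\<close> by (metis mult_left_cancel)
  then show False using irreducible by blast
qed

lemma quad_norm_surj: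
  fixes c :: "'a::{field,finite}"
  assumes "1 + 4 * c \<noteq> 0"
  shows "\<exists>u. quad_norm c u = d"
proof -
  have "(-1) * (-1) \<noteq> 4 * 1 * (- c)" using assms by (simp add: eq_neg_iff_add_eq_0 add.commute)
  from binary_quadratic_form_surj[OF this]
  obtain a b where "1 * (a * a) + (-1) * (a * b) + (- c) * (b * b) = d" by blast
  then have "quad_norm c (a, b) = d" by (simp add: quad_norm_Pair algebra_simps)
  then show ?thesis by blast
qed

context
  fixes c :: "'a::{field,finite}"
  assumes irreducible: "\<forall>x. x * x + x \<noteq> c"
begin

interpretation K: field "quad_ext c"
  by (rule field_quad_ext[OF irreducible])

lemma group_hom_quad_norm: "group_hom (mult_of (quad_ext c)) mult_group (quad_norm c)"
proof (intro group_hom.intro group_hom_axioms.intro K.field_mult_group group_mult_group homI)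
  show "quad_norm c u \<in> carrier mult_group" if "u \<in> carrier (mult_of (quad_ext c))" for u
    using that by (simp add: quad_norm_eq_0_iff[OF irreducible])
qed (simp add: quad_norm_mult)

lemma quad_norm_image: "quad_norm c ` carrier (mult_of (quad_ext c)) = carrier mult_group"
proof
  show "quad_norm c ` carrier (mult_of (quad_ext c)) \<subseteq> carrier mult_group"
    by (auto simp: quad_norm_eq_0_iff[OF irreducible])
  show "carrier mult_group \<subseteq> quad_norm c ` carrier (mult_of (quad_ext c))"
  proof
    fix d :: 'a assume "d \<in> carrier mult_group"
    moreover obtain u where "quad_norm c u = d"
      using quad_norm_surj[OF disc_nonzero_if_irreducible[OF irreducible]] by blast
    ultimately show "d \<in> quad_norm c ` carrier (mult_of (quad_ext c))"
      using quad_norm_eq_0_iff[OF irreducible, of u] by auto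
  qed
qed

lemma kernel_quad_norm:
  "kernel (mult_of (quad_ext c)) mult_group (quad_norm c) = {u. quad_norm c u = 1}"
  by (auto simp: kernel_def quad_norm_Pair)

lemma card_quad_norm_one: "card {u. quad_norm c u = 1} = CARD('a) + 1"
proof -
  let ?M = "mult_of (quad_ext c)" and ?F = "mult_group :: 'a monoid" and ?q = "CARD('a)"
  have "order ?M = ?q * ?q - 1" "order ?F = ?q - 1" by (simp_all add: order_def)
  then have "(?q - 1) * card {u. quad_norm c u = 1} = ?q * ?q - 1"
    using group_hom.order_eq_order_times_card_kernel[OF group_hom_quad_norm quad_norm_image]
    by (simp only: kernel_quad_norm)
  also have "\<dots> = (?q - 1) * (?q + 1)" by (simp add: algebra_simps)
  finally show ?thesis using two_le_CARD_field[where 'a = 'a] by (simp del: mult_Suc_right)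
qed

lemma norm_torus_cyclic_if_irreducible:
  obtains t where "t \<in> carrier SL2" "generate SL2 {t} = norm_torus c" "SL2.ord t = CARD('a) + 1"
proof -
  let ?M = "mult_of (quad_ext c)" and ?F = "mult_group :: 'a monoid"
  interpret M: group ?M by (rule K.field_mult_group)
  interpret N: group_hom ?M ?F "quad_norm c" by (rule group_hom_quad_norm)
  have fin: "finite (carrier ?M)" by simp
  obtain g where g: "g \<in> carrier ?M" "generate ?M {g} = carrier ?M"
    using K.mult_of_eq_generate by (metis finite quad_ext_simps(1))
  define u where "u = g [^]\<^bsub>?M\<^esub> order ?F"
  have u: "u \<in> carrier ?M" using g(1) unfolding u_def by (rule M.nat_pow_closed)
  have kernel: "{u. quad_norm c u = 1} = generate ?M {u}"
    using N.kernel_eq_generate[OF quad_norm_image fin g] by (simp only: kernel_quad_norm u_def)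
  define t where "t = quad_mat c u"
  have "u \<in> generate ?M {u}" by (simp add: generate.incl)
  then have t: "t \<in> carrier SL2" by (simp add: t_def quad_mat_in_SL2_iff flip: kernel)
  have "generate SL2 {t} = {quad_mat c (u [^]\<^bsub>?M\<^esub> n) | n::nat. n \<in> UNIV}"
    unfolding SL2.generate_pow_on_finite_carrier[OF finite_SL2 t]
    by (simp add: t_def quad_mat_pow nat_pow_mult_of)
  also have "\<dots> = norm_torus c"
    unfolding norm_torus_def kernel M.generate_pow_on_finite_carrier[OF fin u] by blast
  finally have gen: "generate SL2 {t} = norm_torus c" .
  have "SL2.ord t = CARD('a) + 1"
    by (simp add: SL2.generate_pow_card[OF t] gen norm_torus_def card_quad_norm_one
        card_image[OF inj_on_subset[OF inj_quad_mat subset_UNIV]])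
  then show ?thesis using that t gen by blast
qed

end

lemma mult_group_cyclic:
  obtains l :: "'a::{field,finite}" where "l \<noteq> 0" "generate mult_group {l} = UNIV - {0}"
proof -
  obtain c :: 'a where c: "\<forall>x. x * x + x \<noteq> c" using irreducible_quadratic_exists by blast
  interpret K: field "quad_ext c" by (rule field_quad_ext[OF c])
  interpret N: group_hom "mult_of (quad_ext c)" mult_group "quad_norm c"
    by (rule group_hom_quad_norm[OF c])
  obtain g where g: "g \<in> carrier (mult_of (quad_ext c))"
    "generate (mult_of (quad_ext c)) {g} = carrier (mult_of (quad_ext c))"
    using K.mult_of_eq_generate by (metis finite quad_ext_simps(1))
  have "generate mult_group {quad_norm c g} = UNIV - {0}"
    using N.generate_img[of "{g}"] g quad_norm_image[OF c] by simp
  moreover have "quad_norm c g \<noteq> 0" using N.hom_closed[OF g(1)] by simp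
  ultimately show ?thesis using that by blast
qed

lemma norm_torus_zero_cyclic:
  obtains t :: "'a::{field,finite} mat2"
  where "t \<in> carrier SL2" "generate SL2 {t} = norm_torus 0" "SL2.ord t = CARD('a) - 1"
proof -
  let ?f = "\<lambda>l :: 'a. quad_mat 0 (l, l - 1 / l)"
  have "?f \<in> hom mult_group SL2"
    by (rule homI) (auto simp: quad_mat_Pair field_simps)
  then interpret f: group_hom mult_group SL2 ?f
    by (intro group_hom.intro group_hom_axioms.intro group_mult_group group_SL2)
  have image: "?f ` (UNIV - {0}) = norm_torus 0"
  proof (intro equalityI subsetI)
    fix s assume "s \<in> norm_torus (0 :: 'a)"
    then obtain a b where s: "s = quad_mat 0 (a, b)" "a * (a - b) = 1"
      by (auto simp: norm_torus_def quad_norm_Pair algebra_simps)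
    then have "a \<noteq> 0" by auto
    moreover have "b = a - 1 / a" using s(2) \<open>a \<noteq> 0\<close> by (simp add: field_simps)
    ultimately show "s \<in> ?f ` (UNIV - {0})" using s(1) by blast
  qed (auto simp: norm_torus_def quad_norm_Pair field_simps)
  obtain l :: 'a where l: "l \<noteq> 0" "generate mult_group {l} = UNIV - {0}" by (rule mult_group_cyclic)
  have t: "?f l \<in> carrier SL2" using f.hom_closed l(1) by simp
  have gen: "generate SL2 {?f l} = norm_torus 0"
    using f.generate_img[of "{l}"] l image by simp
  have "inj_on ?f (UNIV - {0})" by (auto simp: inj_on_def quad_mat_Pair)
  then have "card (norm_torus (0 :: 'a)) = CARD('a) - 1"
    unfolding image[symmetric] by (simp add: card_image)
  then have "SL2.ord (?f l) = CARD('a) - 1" using SL2.generate_pow_card[OF t] gen by simp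
  then show ?thesis using that[OF t gen] by blast
qed

theorem SL2_cyclic_torus_exists:
  assumes "N = CARD('a::{field,finite}) - 1 \<or> N = CARD('a) + 1"
  obtains t :: "'a::{field,finite} mat2" where "t \<in> carrier SL2" "SL2.ord t = N"
    "rank_one_torus SL2 (generate SL2 {t}) SL2_centre"
  using assms
proof
  assume N: "N = CARD('a) - 1"
  obtain t :: "'a mat2" where "t \<in> carrier SL2" "generate SL2 {t} = norm_torus 0"
    "SL2.ord t = CARD('a) - 1"
    by (rule norm_torus_zero_cyclic)
  then show ?thesis using that rank_one_torus_norm_torus[of "0 :: 'a"] N by simp
next
  assume N: "N = CARD('a) + 1"
  obtain c :: 'a where c: "\<forall>x. x * x + x \<noteq> c" using irreducible_quadratic_exists by blast
  obtain t where "t \<in> carrier SL2" "generate SL2 {t} = norm_torus c" "SL2.ord t = CARD('a) + 1"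
    by (rule norm_torus_cyclic_if_irreducible[OF c])
  then show ?thesis
    using that rank_one_torus_norm_torus[OF disc_nonzero_if_irreducible[OF c]] N by simp
qed

section \<open>The unipotent subgroup and the characteristic\<close>

definition unipotent :: "'a::field mat2 set" where
  "unipotent = range (\<lambda>b. (1, b, 0, 1))"

lemma unipotent_subgroup: "subgroup unipotent SL2"
  by (rule SL2.subgroupI) (auto simp: unipotent_def inv_SL2)

lemma card_unipotent: "card (unipotent :: 'a::{field,finite} mat2 set) = CARD('a)"
  unfolding unipotent_def by (rule card_image) (simp add: inj_on_def)

lemma unipotent_pow: "(1, b, 0, 1) [^]\<^bsub>SL2\<^esub> n = (1, of_nat n * b, 0, 1)" for n :: nat
  by (induction n) (simp_all add: one_SL2 algebra_simps)

lemma prime_CHAR_finite_field: "prime CHAR('a::{field,finite})"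
  by (intro prime_CHAR_semidom finite_imp_CHAR_pos finite)

lemma CHAR_eq_if_prime_dvd_CARD:
  assumes r: "prime r" and r_dvd: "r dvd CARD('a::{field,finite})"
  shows "CHAR('a) = r"
proof -
  let ?U = "SL2\<lparr>carrier := unipotent :: 'a mat2 set\<rparr>"
  have "order ?U = r ^ 1 * (CARD('a) div r)" using r_dvd by (simp add: order_def card_unipotent)
  from sylow_thm[OF r SL2.subgroup_imp_group[OF unipotent_subgroup] this]
  obtain P where P: "subgroup P ?U" "card P = r" by auto
  have "P \<noteq> {\<one>\<^bsub>SL2\<^esub>}" using P(2) r by auto
  moreover have "\<one>\<^bsub>SL2\<^esub> \<in> P" using subgroup.one_closed[OF P(1)] by simp
  ultimately obtain x where x: "x \<in> P" "x \<noteq> \<one>\<^bsub>SL2\<^esub>" by blast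
  then obtain b where b: "x = (1, b, 0, 1)" "b \<noteq> 0"
    using subgroup.subset[OF P(1)] by (fastforce simp: unipotent_def one_SL2)
  have "SL2.ord x dvd r"
    using SL2.ord_dvd_card_subgroup[OF SL2.incl_subgroup[OF unipotent_subgroup P(1)] x(1)] P(2)
    by simp
  then have "x [^]\<^bsub>SL2\<^esub> r = \<one>\<^bsub>SL2\<^esub>" using b(1) by (simp add: SL2.pow_eq_id)
  then have "CHAR('a) dvd r"
    using b by (simp add: unipotent_pow one_SL2 of_nat_eq_0_iff_char_dvd)
  then show ?thesis using r prime_CHAR_finite_field primes_dvd_imp_eq by blast
qed

lemma CARD_eq_CHAR_power: "\<exists>k. CARD('a::{field,finite}) = CHAR('a) ^ k"
proof -
  have "CARD('a) \<noteq> 0" by simp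
  then obtain n where n: "CARD('a) = CHAR('a) ^ multiplicity CHAR('a) CARD('a) * n"
    "\<not> CHAR('a) dvd n"
    using multiplicity_decompose'[of "CARD('a)" "CHAR('a)"] prime_CHAR_finite_field[where 'a = 'a]
      not_prime_unit by metis
  have "n = 1"
  proof (rule ccontr)
    assume "n \<noteq> 1"
    then obtain r where r: "prime r" "r dvd n" using prime_factor_nat by blast
    then have "r dvd CARD('a)" using n(1) by (metis dvd_mult)
    then have "CHAR('a) = r" using r(1) by (rule CHAR_eq_if_prime_dvd_CARD[rotated])
    then show False using r(2) n(2) by simp
  qed
  then show ?thesis using n(1) by auto
qed

lemma CARD_prime_power:
  assumes "prime p" "p dvd CARD('a::{field,finite})"
  shows "\<exists>k. CARD('a) = p ^ k"
  using CARD_eq_CHAR_power[where 'a = 'a] CHAR_eq_if_prime_dvd_CARD[OF assms] by simp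

lemma two_neq_zero_if_odd_CARD:
  assumes "odd CARD('a::{field,finite})"
  shows "(2 :: 'a) \<noteq> 0"
proof
  assume "(2 :: 'a) = 0"
  then have "of_nat 2 = (0 :: 'a)" by simp
  then have "CHAR('a) dvd 2" by (simp only: of_nat_eq_0_iff_char_dvd)
  then have "CHAR('a) = 2" using prime_CHAR_finite_field primes_dvd_imp_eq two_is_prime_nat by blast
  moreover obtain k where "CARD('a) = CHAR('a) ^ k" using CARD_eq_CHAR_power by blast
  ultimately show False using assms two_le_CARD_field[where 'a = 'a] by (cases k) auto
qed

section \<open>Redundant Sylow subgroups of SL(2,q)\<close>

lemma finite_group_prime_SL2:
  assumes "prime p"
  shows "finite_group_prime (SL2 :: 'a::{field,finite} mat2 monoid) p"
  by (intro finite_group_prime.intro finite_group_prime_axioms.intro group_SL2 finite_SL2 assms)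

lemma unipotent_Sylow:
  assumes p: "prime p" "p dvd CARD('a::{field,finite})"
  shows "(unipotent :: 'a mat2 set) \<in> Sylow_subgroups SL2 p"
proof -
  let ?q = "CARD('a)"
  have q: "2 \<le> ?q" by (rule two_le_CARD_field)
  obtain k where k: "?q = p ^ k" using CARD_prime_power[OF p] by blast
  have "\<not> p dvd ?q - 1" using p dvd_diff_nat[of p ?q "?q - 1"] q by auto
  moreover have "\<not> p dvd ?q + 1" using p dvd_diff_nat[of p "?q + 1" ?q] by auto
  ultimately have "\<not> p dvd (?q - 1) * (?q + 1)" using p(1) prime_dvd_mult_iff by blast
  then have "multiplicity p ((?q - 1) * (?q + 1) * ?q) = multiplicity p ?q"
    using p(1) by (intro multiplicity_prime_elem_times_other) auto
  also have "\<dots> = k" using p(1) by (simp add: k)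
  finally have "multiplicity p (order (SL2 :: 'a mat2 monoid)) = k"
    by (simp only: order_SL2 mult.commute)
  then show ?thesis by (simp add: Sylow_subgroups_def unipotent_subgroup card_unipotent k)
qed

lemma conj_by_unipotent:
  assumes "(a, b, c, d) \<in> carrier SL2"
  shows "SL2.conj_by (a, b, c, d) (1, t, 0, 1) =
    (1 - t * a * c, t * a * a, - t * c * c, 1 + t * a * c)"
proof -
  have det: "a * d - b * c = 1" using assms by simp
  have "a * d - (a * t + b) * c = (a * d - b * c) - t * a * c"
    "(c * t + d) * a - c * b = (a * d - b * c) + t * a * c"
    by (simp_all add: algebra_simps)
  then show ?thesis using det by (simp add: inv_SL2 algebra_simps)
qed

theorem not_redundant_SL2_if_dvd:
  assumes p: "prime p" "p dvd CARD('a::{field,finite})"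
  shows "\<not> has_redundant_Sylow (SL2 :: 'a mat2 monoid) p"
proof -
  let ?G = "SL2 :: 'a mat2 monoid" and ?x = "(1, 1, 0, 1) :: 'a mat2"
  interpret finite_group_prime ?G p by (rule finite_group_prime_SL2[OF p(1)])
  note U = unipotent_Sylow[OF p]
  have x: "?x \<in> unipotent" by (simp add: unipotent_def)
  have "Q = unipotent" if Q: "Q \<in> Sylow_subgroups ?G p" "?x \<in> Q" for Q
  proof -
    obtain g where g: "g \<in> carrier ?G" "Q = SL2.conj_by g ` unipotent"
      using Sylow_conj[OF U Q(1)] by blast
    obtain a b c d where g_eq: "g = (a, b, c, d)" by (cases g)
    have Q_eq: "Q = range (\<lambda>t. (1 - t * a * c, t * a * a, - t * c * c, 1 + t * a * c))"
      using g(1) unfolding g(2) g_eq unipotent_def image_image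
      by (intro image_cong refl conj_by_unipotent)
    then obtain t where "t * a * a = 1" "t * c * c = 0" using Q(2) by auto
    then have "c = 0" by auto
    then have "Q \<subseteq> unipotent" unfolding Q_eq unipotent_def by auto
    then show ?thesis by (rule Sylow_eqI[OF Q(1) U])
  qed
  then have "in_unique_Sylow ?G p ?x" unfolding in_unique_Sylow_def using U x by blast
  moreover have "?x \<in> p_elements ?G p" using Sylow_subset_p_elements[OF U] x by blast
  ultimately show ?thesis using has_redundant_Sylow_iff by blast
qed

theorem not_redundant_SL2_if_odd:
  assumes p: "prime p" "odd p" and not_dvd: "\<not> p dvd CARD('a::{field,finite})"
  shows "\<not> has_redundant_Sylow (SL2 :: 'a mat2 monoid) p"
proof -
  let ?G = "SL2 :: 'a mat2 monoid" and ?q = "CARD('a)"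
  interpret finite_group_prime ?G p by (rule finite_group_prime_SL2[OF p(1)])
  have "\<not> (p dvd ?q - 1 \<and> p dvd ?q + 1)"
  proof
    assume "p dvd ?q - 1 \<and> p dvd ?q + 1"
    then have "p dvd (?q + 1) - (?q - 1)" using dvd_diff_nat by blast
    then have "p dvd 2" using two_le_CARD_field[where 'a = 'a] by simp
    then show False using p primes_dvd_imp_eq two_is_prime_nat by blast
  qed
  then have "multiplicity p (?q - 1) = 0 \<or> multiplicity p (?q + 1) = 0"
    by (auto simp: not_dvd_imp_multiplicity_0)
  then obtain N where N: "N = ?q - 1 \<or> N = ?q + 1" "multiplicity p N = multiplicity p (order ?G)"
    using multiplicity_order_SL2[OF p(1) not_dvd] by (metis add_0 add_0_right)
  obtain t :: "'a mat2" where t: "t \<in> carrier SL2" "SL2.ord t = N"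
    using SL2_cyclic_torus_exists[OF N(1)] by blast
  show ?thesis using not_redundant_if_multiplicity_ord_eq[OF t(1)] t(2) N(2) by simp
qed

lemma half_Sylow_torus_SL2:
  fixes t :: "'a::{field,finite} mat2"
  assumes two: "(2 :: 'a) \<noteq> 0" and t: "t \<in> carrier SL2"
    and torus: "rank_one_torus SL2 (generate SL2 {t}) SL2_centre"
    and four_dvd: "4 dvd SL2.ord t"
    and multiplicity:
      "multiplicity 2 (order (SL2 :: 'a mat2 monoid)) = multiplicity 2 (SL2.ord t) + 1"
  shows "half_Sylow_torus SL2 t (-1, 0, 0, -1)"
proof -
  let ?z = "(-1, 0, 0, -1) :: 'a mat2"
  have z: "?z \<in> carrier SL2" by simp
  have "?z \<noteq> \<one>\<^bsub>SL2\<^esub>"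
  proof
    assume "?z = \<one>\<^bsub>SL2\<^esub>"
    then have "(-1 :: 'a) = 1" by (simp add: one_SL2)
    then show False using two by (metis add.right_inverse one_add_one)
  qed
  moreover have "?z [^]\<^bsub>SL2\<^esub> (2::nat) = \<one>\<^bsub>SL2\<^esub>" by (simp add: numeral_2_eq_2 one_SL2)
  ultimately have ord_z: "SL2.ord ?z = 2"
    using SL2.pow_eq_id[OF z] SL2.ord_eq_1[OF z] prime_nat_iff two_is_prime_nat by blast
  have square_eq_z: "\<exists>g\<in>carrier SL2. y' = SL2.conj_by g y"
    if "y \<in> carrier SL2" "y' \<in> carrier SL2" "y \<otimes>\<^bsub>SL2\<^esub> y = ?z" "y' \<otimes>\<^bsub>SL2\<^esub> y' = ?z"
    for y y' :: "'a mat2"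
  proof -
    have "trace2 y = 0" "trace2 y' = 0"
      using that by (blast intro: trace2_eq_zero_if_square_eq_minus_one)+
    moreover have "(4 :: 'a) \<noteq> 0" using two by (simp add: four_eq_zero_iff)
    ultimately show ?thesis using that by (intro conj_if_trace2_eq) auto
  qed
  have "SL2_centre = {\<one>\<^bsub>SL2\<^esub>, ?z}" by (simp add: SL2_centre_def one_SL2)
  then show ?thesis
    using torus t z ord_z square_eq_one_SL2[OF two] square_eq_z four_dvd multiplicity
    by (intro half_Sylow_torus.intro half_Sylow_torus_axioms.intro finite_group_prime_SL2) auto
qed

lemma multiplicity_two_neighbours:
  fixes q N :: nat
  assumes q: "2 \<le> q" and N: "N = q - 1 \<or> N = q + 1" "4 dvd N"
  shows "multiplicity 2 (q - 1) + multiplicity 2 (q + 1) = multiplicity 2 N + 1"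
proof -
  have other: "multiplicity 2 (4 * k + 2 :: nat) = 1" for k
  proof -
    have "multiplicity 2 (2 * (2 * k + 1)) = Suc (multiplicity 2 (2 * k + 1))"
      by (rule multiplicity_times_same) auto
    then show ?thesis by (simp add: not_dvd_imp_multiplicity_0)
  qed
  obtain k where k: "N = 4 * k" using N(2) by (rule dvdE)
  from N(1) show ?thesis
  proof
    assume "N = q - 1"
    then show ?thesis using other[of k] k q by simp
  next
    assume N_eq: "N = q + 1"
    then have "q - 1 = 4 * (k - 1) + 2" using k q by auto
    then show ?thesis using other[of "k - 1"] N_eq by simp
  qed
qed

lemma power_two_neighbour_iff:
  fixes q N :: nat
  assumes q: "2 \<le> q" and N: "N = q - 1 \<or> N = q + 1" "4 dvd N"
  shows "(\<exists>j. N = 2 ^ j) \<longleftrightarrow> (\<exists>k. q + 1 = 2 ^ k \<or> q = 2 ^ k + 1)"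
proof
  assume "\<exists>j. N = 2 ^ j"
  then obtain j where "N = 2 ^ j" by blast
  then have "q + 1 = 2 ^ j \<or> q = 2 ^ j + 1" using N(1) q by auto
  then show "\<exists>k. q + 1 = 2 ^ k \<or> q = 2 ^ k + 1" by blast
next
  assume "\<exists>k. q + 1 = 2 ^ k \<or> q = 2 ^ k + 1"
  then obtain k where k: "2 ^ k = q - 1 \<or> 2 ^ k = q + 1" by fastforce
  show "\<exists>j. N = 2 ^ j"
  proof (cases "4 dvd (2::nat) ^ k")
    case True
    then obtain i :: nat where i: "2 ^ k = 4 * i" by (rule dvdE)
    obtain j where j: "N = 4 * j" using N(2) by (rule dvdE)
    have "N = 2 ^ k" using k N(1) q unfolding i j by presburger
    then show ?thesis by blast
  next
    case False
    then have "k < 2" using le_imp_power_dvd[of 2 k "2::nat"] by (cases "2 \<le> k") auto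
    then have "q = 2 \<or> q = 3" using k q by (auto simp: less_2_cases_iff)
    then have "N = 2 ^ 2" using N by auto
    then show ?thesis by blast
  qed
qed

theorem has_redundant_Sylow_SL2_two_iff:
  assumes odd: "odd CARD('a::{field,finite})"
  shows "has_redundant_Sylow (SL2 :: 'a mat2 monoid) 2 \<longleftrightarrow>
    \<not> (\<exists>k. CARD('a) + 1 = 2 ^ k \<or> CARD('a) = 2 ^ k + 1)"
proof -
  let ?q = "CARD('a)"
  have "4 dvd ?q - 1 \<or> 4 dvd ?q + 1" using odd by presburger
  then obtain N where N: "N = ?q - 1 \<or> N = ?q + 1" "4 dvd N" by blast
  obtain t :: "'a mat2" where t: "t \<in> carrier SL2" "SL2.ord t = N"
    "rank_one_torus SL2 (generate SL2 {t}) SL2_centre"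
    by (rule SL2_cyclic_torus_exists[OF N(1)])
  have "multiplicity 2 (order (SL2 :: 'a mat2 monoid)) = multiplicity 2 (SL2.ord t) + 1"
    using multiplicity_order_SL2[of 2, where 'a = 'a] odd t(2)
      multiplicity_two_neighbours[OF two_le_CARD_field N] by simp
  then have "half_Sylow_torus SL2 t (-1, 0, 0, -1)"
    using N(2) t by (intro half_Sylow_torus_SL2 two_neq_zero_if_odd_CARD odd) simp_all
  from half_Sylow_torus.has_redundant_Sylow_two_iff[OF this] show ?thesis
    using power_two_neighbour_iff[OF two_le_CARD_field N] t(2) by simp
qed

theorem has_redundant_Sylow_SL2_iff:
  assumes p: "prime p"
  shows "has_redundant_Sylow (SL2 :: 'a::{field,finite} mat2 monoid) p \<longleftrightarrow>
    p = 2 \<and> \<not> (\<exists>k. CARD('a) + 1 = 2 ^ k \<or> CARD('a) = 2 ^ k \<or> CARD('a) = 2 ^ k + 1)"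
proof -
  consider (char) "p dvd CARD('a)" | (odd) "p \<noteq> 2" "\<not> p dvd CARD('a)"
    | (two) "p = 2" "odd CARD('a)" by blast
  then show ?thesis
  proof cases
    case char
    then show ?thesis using not_redundant_SL2_if_dvd[OF p] CARD_prime_power[OF p] by blast
  next
    case odd
    then have "odd p" using p primes_dvd_imp_eq two_is_prime_nat by blast
    then show ?thesis using not_redundant_SL2_if_odd[OF p] odd by blast
  next
    case two
    have "CARD('a) \<noteq> 2 ^ k" for k
      using two(2) two_le_CARD_field[where 'a = 'a] by (cases k) auto
    then show ?thesis using has_redundant_Sylow_SL2_two_iff[OF two(2)] two(1) by blast
  qed
qed

section \<open>Passage to PSL(2,q)\<close>

lemma SL2_centre_subgroup: "subgroup SL2_centre SL2"
  by (rule SL2.subgroupI) (auto simp: SL2_centre_def inv_SL2)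

lemma SL2_centre_commute:
  assumes "k \<in> SL2_centre"
  shows "k \<otimes>\<^bsub>SL2\<^esub> g = g \<otimes>\<^bsub>SL2\<^esub> k"
  using assms by (cases g) (auto simp: SL2_centre_def)

corollary has_redundant_Sylow_PSL2_iff:
  assumes "prime p"
  shows "has_redundant_Sylow (PSL2 :: 'a::{field,finite} mat2 set monoid) p \<longleftrightarrow>
    has_redundant_Sylow (SL2 :: 'a mat2 monoid) p"
  unfolding PSL2_def
  by (intro finite_group_prime.has_redundant_Sylow_Mod_iff finite_group_prime_SL2 assms
      SL2_centre_subgroup SL2_centre_commute)

theorem theoremD:
  fixes p :: nat
  assumes "prime p"
  shows "(has_redundant_Sylow (SL2 :: ('a::{field,finite} * 'a * 'a * 'a) monoid) p \<longleftrightarrow>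
            p = 2 \<and> \<not> (\<exists>k::nat. int (card (UNIV :: 'a set)) = 2 ^ k - 1 \<or> int (card (UNIV :: 'a set)) = 2 ^ k
                                  \<or> int (card (UNIV :: 'a set)) = 2 ^ k + 1))
       \<and> (has_redundant_Sylow (PSL2 :: ('a * 'a * 'a * 'a) set monoid) p \<longleftrightarrow>
            p = 2 \<and> \<not> (\<exists>k::nat. int (card (UNIV :: 'a set)) = 2 ^ k - 1 \<or> int (card (UNIV :: 'a set)) = 2 ^ k
                                  \<or> int (card (UNIV :: 'a set)) = 2 ^ k + 1))"
proof -
  have "int n = 2 ^ k - 1 \<longleftrightarrow> n + 1 = 2 ^ k" "int n = 2 ^ k \<longleftrightarrow> n = 2 ^ k"
    "int n = 2 ^ k + 1 \<longleftrightarrow> n = 2 ^ k + 1" for n k :: nat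
  proof -
    have "(2::int) ^ k = int (2 ^ k)" by simp
    then show "int n = 2 ^ k - 1 \<longleftrightarrow> n + 1 = 2 ^ k" "int n = 2 ^ k \<longleftrightarrow> n = 2 ^ k"
      "int n = 2 ^ k + 1 \<longleftrightarrow> n = 2 ^ k + 1" by linarith+
  qed
  then show ?thesis
    using has_redundant_Sylow_SL2_iff[OF assms, where 'a = 'a]
      has_redundant_Sylow_PSL2_iff[OF assms, where 'a = 'a] by simp
qed

end
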